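(* Let $\mathcal{S}=\mathcal{L}\oplus\mathcal{F}^{-1/2}$ be the Krichever–Novikov Lie superalgebra of $(\Sigma,A,L)$. Let $C$ be any closed (differentiable) curve on $\Sigma$ not meeting the points in $A$, and let $R$ be any holomorphic projective connection on $\Sigma$. Then the bilinear extension of $$\Phi_{C,R}(e,f):=\frac1{24\pi\mathrm{i}}\int_C\Big(\tfrac12(e'''f-ef''')-R\cdot(e'f-ef')\Big)dz,$$ $$\Phi_{C,R}(\varphi,\psi):=-\frac1{24\pi\mathrm{i}}\int_C\big(\varphi''\cdot\psi+\varphi\cdot\psi''-R\cdot\varphi\cdot\psi\big)dz,$$ $$\Phi_{C,R}(e,\varphi):=0$$ for $e,f\in\mathcal{L}$, $\varphi,\psi\in\mathcal{F}^{-1/2}$ gives an (even) Lie superalgebra cocycle for $\mathcal{S}$, and hence defines a central extension of $\mathcal{S}$.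
   Context: **Algebras.** $\Sigma$ is a compact Riemann surface of arbitrary genus $g$, $A\subset\Sigma$ a finite set, $\mathcal{K}$ the canonical line bundle, $L$ a fixed line bundle with $L^{\otimes 2}=\mathcal{K}$ (theta characteristic). For $\lambda\in\frac12\mathbb{Z}$, $\mathcal{K}^\lambda:=L^{\otimes 2\lambda}$ (negative powers via the dual bundle), and $\mathcal{F}^\lambda$ is the complex vector space of global meromorphic sections of $\mathcal{K}^\lambda$ holomorphic on $\Sigma\setminus A$. Locally elements are $f(z)(dz)^\lambda$; the same symbol is used for a section and its local representing function, and $'$ is $d/dz$. $\mathcal{L}:=\mathcal{F}^{-1}$ (vector fields) with the Lie bracket $[e,f]=(ef'-fe')\frac{d}{dz}$. For $e\in\mathcal{L}$, $\varphi\in\mathcal{F}^{-1/2}$: $e.\varphi=(e\varphi'-\frac12\varphi e')(dz)^{-1/2}$. For $\varphi,\psi\in\mathcal{F}^{-1/2}$, $\varphi\cdot\psi\in\mathcal{L}$ is the product of sections. $\mathcal{S}:=\mathcal{L}\oplus\mathcal{F}^{-1/2}$, with even part $\mathcal{S}_{\bar0}=\mathcal{L}$, odd part $\mathcal{S}_{\bar1}=\mathcal{F}^{-1/2}$, is the Lie superalgebra with bracket extending that of $\mathcal{L}$ by $[e,\varphi]=-[\varphi,e]=e.\varphi$, $[\varphi,\psi]=\varphi\cdot\psi$. **Cocycles.** An even super-cocycle is a bilinear $c:\mathcal{S}\times\mathcal{S}\to\mathbb{C}$ vanishing on pairs of elements of different parity (in both orders), with $c(x,y)=-(-1)^{\bar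 x\bar y}c(y,x)$ and $$(-1)^{\bar x\bar z}c(x,[y,z])+(-1)^{\bar y\bar x}c(y,[z,x])+(-1)^{\bar z\bar y}c(z,[x,y])=0$$ for $x,y,z$ of pure parity. The associated central extension is $\widehat{\mathcal{S}}=\mathbb{C}t\oplus\mathcal{S}$ with $t$ even and central and $[\hat x,\hat y]=\widehat{[x,y]}+c(x,y)t$, $\hat x=(0,x)$. **Projective connection.** A holomorphic projective connection $R$ is a system of local holomorphic functions $R_\alpha(z_\alpha)$ for a covering $(U_\alpha,z_\alpha)$ of $\Sigma$ by holomorphic coordinates with transition functions $z_\beta=f_{\beta\alpha}(z_\alpha)$, satisfying $R_\beta(z_\beta)(f_{\beta\alpha}')^2=R_\alpha(z_\alpha)+S(f_{\beta\alpha})$, where $S(h)=\frac{h'''}{h'}-\frac32\left(\frac{h''}{h'}\right)^2$ and $'$ is differentiation with respect to $z_\alpha$. The integrands above are written in local coordinates with local representatives of the sections and of $R$; that they are well-defined differentials (independent of the coordinates) is part of the assertion. *)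

theory Defs
  imports
    "HOL-Complex_Analysis.Complex_Analysis"
    "HOL-Library.Function_Algebras"
begin

section \<open>Lie superalgebras, cocycles, central extensions\<close>

text \<open>
  The vector space operations \<open>+\<close> and \<open>0\<close> come from the ambient type; scalar multiplication is
  explicit. \<open>part A 0\<close> and \<open>part A 1\<close> are the even and the odd part, so parities are the numbers
  0 and 1, added modulo 2.
\<close>

record 'v superspace =
  scl  :: "complex \<Rightarrow> 'v \<Rightarrow> 'v"
  part :: "nat \<Rightarrow> 'v set"

record 'v superalgebra = "'v superspace" +
  brk  :: "'v \<Rightarrow> 'v \<Rightarrow> 'v"

definition total :: "('v::ab_group_add, 'm) superspace_scheme \<Rightarrow> 'v set" where
  "total A = {x + y | x y. x \<in> part A 0 \<and> y \<in> part A 1}"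

definition is_superspace :: "('v::ab_group_add, 'm) superspace_scheme \<Rightarrow> bool" where
  "is_superspace A \<longleftrightarrow>
     vector_space (scl A) \<and>
     module.subspace (scl A) (part A 0) \<and>
     module.subspace (scl A) (part A 1) \<and>
     part A 0 \<inter> part A 1 = {0}"

definition bilinear_map_on ::
  "(complex \<Rightarrow> 'v \<Rightarrow> 'v) \<Rightarrow> (complex \<Rightarrow> 'w \<Rightarrow> 'w) \<Rightarrow> 'v set \<Rightarrow>
     ('v::ab_group_add \<Rightarrow> 'v \<Rightarrow> 'w::ab_group_add) \<Rightarrow> bool" where
  "bilinear_map_on s s' V b \<longleftrightarrow>
     (\<forall>x\<in>V. \<forall>y\<in>V. \<forall>z\<in>V. b (x + y) z = b x z + b y z \<and> b z (x + y) = b z x + b z y) \<and>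
     (\<forall>a. \<forall>x\<in>V. \<forall>z\<in>V. b (s a x) z = s' a (b x z) \<and> b z (s a x) = s' a (b z x))"

definition lie_superalgebra :: "('v::ab_group_add) superalgebra \<Rightarrow> bool" where
  "lie_superalgebra A \<longleftrightarrow>
     is_superspace A \<and>
     bilinear_map_on (scl A) (scl A) (total A) (brk A) \<and>
     (\<forall>p\<in>{0,1}. \<forall>q\<in>{0,1}. \<forall>x\<in>part A p. \<forall>y\<in>part A q.
        brk A x y \<in> part A ((p + q) mod 2) \<and>
        brk A x y = scl A (- ((-1) ^ (p * q))) (brk A y x)) \<and>
     (\<forall>p\<in>{0,1}. \<forall>q\<in>{0,1}. \<forall>r\<in>{0,1}. \<forall>x\<in>part A p. \<forall>y\<in>part A q. \<forall>z\<in>part A r.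
        scl A ((-1) ^ (p * r)) (brk A x (brk A y z)) +
        scl A ((-1) ^ (q * p)) (brk A y (brk A z x)) +
        scl A ((-1) ^ (r * q)) (brk A z (brk A x y)) = 0)"

definition even_super_cocycle ::
  "('v::ab_group_add) superalgebra \<Rightarrow> ('v \<Rightarrow> 'v \<Rightarrow> complex) \<Rightarrow> bool" where
  "even_super_cocycle A c \<longleftrightarrow>
     bilinear_map_on (scl A) (*) (total A) c \<and>
     (\<forall>x\<in>part A 0. \<forall>y\<in>part A 1. c x y = 0 \<and> c y x = 0) \<and>
     (\<forall>p\<in>{0,1}. \<forall>q\<in>{0,1}. \<forall>x\<in>part A p. \<forall>y\<in>part A q.
        c x y = - ((-1) ^ (p * q)) * c y x) \<and>
     (\<forall>p\<in>{0,1}. \<forall>q\<in>{0,1}. \<forall>r\<in>{0,1}. \<forall>x\<in>part A p. \<forall>y\<in>part A q. \<forall>z\<in>part A r.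
        (-1) ^ (p * r) * c x (brk A y z) +
        (-1) ^ (q * p) * c y (brk A z x) +
        (-1) ^ (r * q) * c z (brk A x y) = 0)"

text \<open>\<open>(a, x)\<close> stands for \<open>a t + x\<close>, where \<open>t = (1, 0)\<close>.\<close>

definition extension ::
  "('v::ab_group_add) superalgebra \<Rightarrow> ('v \<Rightarrow> 'v \<Rightarrow> complex) \<Rightarrow> (complex \<times> 'v) superalgebra" where
  "extension A c =
     \<lparr> scl = (\<lambda>a (b, x). (a * b, scl A a x)),
       part = (\<lambda>p. (if p = 0 then UNIV else {0}) \<times> part A p),
       brk = (\<lambda>(a, x) (b, y). (c x y, brk A x y)) \<rparr>"

definition is_central_extension ::
  "('w::ab_group_add) superalgebra \<Rightarrow> 'w \<Rightarrow> ('w \<Rightarrow> 'v) \<Rightarrow> ('v::ab_group_add) superalgebra \<Rightarrow> bool"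
where
  "is_central_extension B t pr A \<longleftrightarrow>
     lie_superalgebra A \<and> lie_superalgebra B \<and>
     t \<in> part B 0 \<and> t \<noteq> 0 \<and> (\<forall>x\<in>total B. brk B t x = 0 \<and> brk B x t = 0) \<and>
     (\<forall>x\<in>total B. \<forall>y\<in>total B. pr (x + y) = pr x + pr y \<and> pr (brk B x y) = brk A (pr x) (pr y)) \<and>
     (\<forall>a. \<forall>x\<in>total B. pr (scl B a x) = scl A a (pr x)) \<and>
     (\<forall>p\<in>{0,1}. pr ` part B p = part A p) \<and>
     {x \<in> total B. pr x = 0} = range (\<lambda>a. scl B a t)"


section \<open>Compact Riemann surfaces\<close>

text \<open>A coordinate is a pair \<open>(U, z)\<close>; the values of \<open>z\<close> outside \<open>U\<close> are irrelevant.\<close>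

type_synonym 'p coordinate = "'p set \<times> ('p \<Rightarrow> complex)"

definition is_chart :: "'p topology \<Rightarrow> 'p coordinate \<Rightarrow> bool" where
  "is_chart X c \<longleftrightarrow>
     openin X (fst c) \<and> open (snd c ` fst c) \<and>
     homeomorphic_map (subtopology X (fst c)) (top_of_set (snd c ` fst c)) (snd c)"

definition overlap :: "'p coordinate \<Rightarrow> 'p coordinate \<Rightarrow> complex set" where
  "overlap c d = snd c ` (fst c \<inter> fst d)"

text \<open>The inverse of a coordinate, and the coordinate change \<open>z\<^sub>d = f (z\<^sub>c)\<close>.\<close>

definition point_at :: "'p coordinate \<Rightarrow> complex \<Rightarrow> 'p" where
  "point_at c = inv_into (fst c) (snd c)"

definition change :: "'p coordinate \<Rightarrow> 'p coordinate \<Rightarrow> complex \<Rightarrow> complex" where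
  "change c d x = snd d (point_at c x)"

definition compatible :: "'p coordinate \<Rightarrow> 'p coordinate \<Rightarrow> bool" where
  "compatible c d \<longleftrightarrow>
     change c d holomorphic_on overlap c d \<and> change d c holomorphic_on overlap d c"

definition riemann_surface :: "'p topology \<Rightarrow> 'p coordinate set \<Rightarrow> bool" where
  "riemann_surface X \<A> \<longleftrightarrow>
     Hausdorff_space X \<and> connected_space X \<and> topspace X \<noteq> {} \<and>
     (\<forall>c\<in>\<A>. is_chart X c) \<and> \<Union> (fst ` \<A>) = topspace X \<and>
     (\<forall>c\<in>\<A>. \<forall>d\<in>\<A>. compatible c d)"

definition compact_riemann_surface :: "'p topology \<Rightarrow> 'p coordinate set \<Rightarrow> bool" where
  "compact_riemann_surface X \<A> \<longleftrightarrow> riemann_surface X \<A> \<and> compact_space X"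

definition holomorphic_coordinate ::
  "'p topology \<Rightarrow> 'p coordinate set \<Rightarrow> 'p coordinate \<Rightarrow> bool" where
  "holomorphic_coordinate X \<A> c \<longleftrightarrow> is_chart X c \<and> (\<forall>d\<in>\<A>. compatible c d)"


section \<open>Line bundles, theta characteristics, meromorphic sections\<close>

text \<open>
  A line bundle is given by local frames over a covering by holomorphic coordinates \<open>(U\<^sub>i, z\<^sub>i)\<close>
  and its transition functions: the local representatives of a section are related by
  \<open>s\<^sub>j = g\<^sub>j\<^sub>i s\<^sub>i\<close>, where \<open>transition L j i\<close> is \<open>g\<^sub>j\<^sub>i\<close>, a function of the point. The same
  coordinate may occur with several frames.
\<close>

record ('i, 'p) hol_bundle =
  index :: "'i set"
  coord :: "'i \<Rightarrow> 'p coordinate"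
  transition :: "'i \<Rightarrow> 'i \<Rightarrow> 'p \<Rightarrow> complex"

abbreviation patch :: "('i, 'p) hol_bundle \<Rightarrow> 'i \<Rightarrow> 'p set" where
  "patch L i \<equiv> fst (coord L i)"

abbreviation z_of :: "('i, 'p) hol_bundle \<Rightarrow> 'i \<Rightarrow> 'p \<Rightarrow> complex" where
  "z_of L i \<equiv> snd (coord L i)"

definition line_bundle ::
  "'p topology \<Rightarrow> 'p coordinate set \<Rightarrow> ('i, 'p) hol_bundle \<Rightarrow> bool" where
  "line_bundle X \<A> L \<longleftrightarrow>
     (\<forall>i\<in>index L. holomorphic_coordinate X \<A> (coord L i)) \<and>
     (\<Union>i\<in>index L. patch L i) = topspace X \<and>
     (\<forall>i\<in>index L. \<forall>j\<in>index L.
        (\<lambda>x. transition L j i (point_at (coord L i) x)) holomorphic_on overlap (coord L i) (coord L j) \<and>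
        (\<forall>p\<in>patch L i \<inter> patch L j. transition L j i p \<noteq> 0)) \<and>
     (\<forall>i\<in>index L. \<forall>j\<in>index L. \<forall>k\<in>index L. \<forall>p\<in>patch L i \<inter> patch L j \<inter> patch L k.
        transition L k i p = transition L k j p * transition L j i p)"

definition tensor_power :: "('i, 'p) hol_bundle \<Rightarrow> int \<Rightarrow> ('i, 'p) hol_bundle" where
  "tensor_power L k = L \<lparr> transition := (\<lambda>j i p. transition L j i p powi k) \<rparr>"

text \<open>
  The canonical bundle, presented by the frames \<open>dz\<^sub>i\<close> over the covering underlying \<open>L\<close>
  (only the covering of \<open>L\<close> is used): \<open>h\<^sub>i dz\<^sub>i = h\<^sub>j dz\<^sub>j\<close> means \<open>h\<^sub>j = (dz\<^sub>j/dz\<^sub>i)\<^bsup>-1\<^esup> h\<^sub>i\<close>.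
\<close>

definition canonical_bundle :: "('i, 'p) hol_bundle \<Rightarrow> ('i, 'p) hol_bundle" where
  "canonical_bundle L =
     L \<lparr> transition := (\<lambda>j i p. inverse (deriv (change (coord L i) (coord L j)) (z_of L i p))) \<rparr>"

definition same_bundle :: "('i, 'p) hol_bundle \<Rightarrow> ('i, 'p) hol_bundle \<Rightarrow> bool" where
  "same_bundle L M \<longleftrightarrow>
     index L = index M \<and> (\<forall>i\<in>index L. coord L i = coord M i) \<and>
     (\<forall>i\<in>index L. \<forall>j\<in>index L. \<forall>p\<in>patch L i \<inter> patch L j. transition L j i p = transition M j i p)"

text \<open>
  \<open>L\<^bsup>\<otimes>2\<^esup> = \<K>\<close>, as an equality of transition functions. Thus the frames of \<open>L\<close> are square
  roots \<open>(dz\<^sub>i)\<^bsup>1/2\<^esup>\<close> of the frames \<open>dz\<^sub>i\<close>, which is what gives a meaning to the local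
  expressions \<open>f(z) (dz)\<^bsup>\<lambda>\<^esup>\<close> for half-integral \<open>\<lambda>\<close>. Every line bundle whose square is
  isomorphic to \<open>\<K>\<close> has such frames near each point (two of them, differing by a sign, over
  every simply connected coordinate patch), so it has a presentation of this kind.
\<close>

definition theta_characteristic ::
  "'p topology \<Rightarrow> 'p coordinate set \<Rightarrow> ('i, 'p) hol_bundle \<Rightarrow> bool" where
  "theta_characteristic X \<A> L \<longleftrightarrow>
     line_bundle X \<A> L \<and> same_bundle (tensor_power L 2) (canonical_bundle L)"

text \<open>
  A section is the family of its local representing functions. A meromorphic section that is
  holomorphic outside the finite set \<open>A\<close> is determined by its values outside \<open>A\<close>; the
  representing functions are normalised to be 0 at the points of \<open>A\<close> (whether or not these are
  poles), outside the patch, and for invalid indices. With this normalisation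
  the sections form a vector space under pointwise operations.
\<close>

type_synonym 'i lsection = "'i \<Rightarrow> complex \<Rightarrow> complex"

definition meromorphic_sections :: "'p set \<Rightarrow> ('i, 'p) hol_bundle \<Rightarrow> 'i lsection set" where
  "meromorphic_sections A L =
     {s. (\<forall>i\<in>index L.
            s i meromorphic_on (z_of L i ` patch L i) \<and>
            s i holomorphic_on (z_of L i ` (patch L i - A))) \<and>
         (\<forall>i x. i \<notin> index L \<or> x \<notin> z_of L i ` (patch L i - A) \<longrightarrow> s i x = 0) \<and>
         (\<forall>i\<in>index L. \<forall>j\<in>index L. \<forall>p\<in>patch L i \<inter> patch L j - A.
            s j (z_of L j p) = transition L j i p * s i (z_of L i p))}"

text \<open>\<open>\<F>\<^bsup>\<lambda>\<^esup>\<close> with \<open>k = 2\<lambda>\<close>.\<close>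

definition F_forms :: "'p set \<Rightarrow> ('i, 'p) hol_bundle \<Rightarrow> int \<Rightarrow> 'i lsection set" where
  "F_forms A L k = meromorphic_sections A (tensor_power L k)"


section \<open>The Krichever--Novikov Lie superalgebra\<close>

definition sec_scale :: "complex \<Rightarrow> 'i lsection \<Rightarrow> 'i lsection" where
  "sec_scale a s = (\<lambda>i x. a * s i x)"

definition sec_mult :: "'i lsection \<Rightarrow> 'i lsection \<Rightarrow> 'i lsection" where
  "sec_mult s u = (\<lambda>i x. s i x * u i x)"

definition vf_bracket :: "'i lsection \<Rightarrow> 'i lsection \<Rightarrow> 'i lsection" where
  "vf_bracket e f = (\<lambda>i x. e i x * deriv (f i) x - f i x * deriv (e i) x)"

definition vf_action :: "'i lsection \<Rightarrow> 'i lsection \<Rightarrow> 'i lsection" where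
  "vf_action e \<phi> = (\<lambda>i x. e i x * deriv (\<phi> i) x - 1/2 * \<phi> i x * deriv (e i) x)"

text \<open>
  An element is a pair \<open>(e, \<phi>)\<close>, standing for \<open>e + \<phi>\<close> with \<open>e \<in> \<L> = \<F>\<^bsup>-1\<^esup>\<close> and
  \<open>\<phi> \<in> \<F>\<^bsup>-1/2\<^esup>\<close>. The bracket below is bilinearly expanded, with \<open>[\<phi>, f] = - f.\<phi>\<close>.
\<close>

definition KN_superalgebra ::
  "'p set \<Rightarrow> ('i, 'p) hol_bundle \<Rightarrow> ('i lsection \<times> 'i lsection) superalgebra" where
  "KN_superalgebra A L =
     \<lparr> scl = (\<lambda>a (e, \<phi>). (sec_scale a e, sec_scale a \<phi>)),
       part = (\<lambda>p. if p = 0 then F_forms A L (-2) \<times> {0} else {0} \<times> F_forms A L (-1)),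
       brk = (\<lambda>(e, \<phi>) (f, \<psi>).
                (vf_bracket e f + sec_mult \<phi> \<psi>, vf_action e \<psi> - vf_action f \<phi>)) \<rparr>"


section \<open>Projective connections\<close>

definition schwarzian :: "(complex \<Rightarrow> complex) \<Rightarrow> complex \<Rightarrow> complex" where
  "schwarzian h x =
     (deriv ^^ 3) h x / deriv h x - 3/2 * ((deriv ^^ 2) h x / deriv h x)\<^sup>2"

definition projective_connection ::
  "'p topology \<Rightarrow> 'p coordinate set \<Rightarrow> 'p coordinate set \<Rightarrow> ('p coordinate \<Rightarrow> complex \<Rightarrow> complex) \<Rightarrow> bool"
where
  "projective_connection X \<A> \<V> R \<longleftrightarrow>
     (\<forall>c\<in>\<V>. holomorphic_coordinate X \<A> c) \<and> \<Union> (fst ` \<V>) = topspace X \<and>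
     (\<forall>c\<in>\<V>. R c holomorphic_on (snd c ` fst c)) \<and>
     (\<forall>c\<in>\<V>. \<forall>d\<in>\<V>. \<forall>x\<in>overlap c d.
        R d (change c d x) * (deriv (change c d) x)\<^sup>2 = R c x + schwarzian (change c d) x)"

text \<open>
  The covering \<open>\<V>\<close> of the projective connection need not contain the coordinates used for the
  sections. Its local representative in an arbitrary holomorphic coordinate \<open>c\<close> is the one
  prescribed by the transformation law; by the chain rule for the Schwarzian derivative it is the
  same for all \<open>d \<in> \<V>\<close>.
\<close>

definition pc_rep ::
  "'p coordinate set \<Rightarrow> ('p coordinate \<Rightarrow> complex \<Rightarrow> complex) \<Rightarrow> 'p coordinate \<Rightarrow> complex \<Rightarrow> complex"
where
  "pc_rep \<V> R c x =
     (THE r. \<forall>d\<in>\<V>. x \<in> overlap c d \<longrightarrow>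
        R d (change c d x) * (deriv (change c d) x)\<^sup>2 = r + schwarzian (change c d) x)"


section \<open>Integration of differentials along curves\<close>

definition closed_differentiable_curve ::
  "'p topology \<Rightarrow> 'p coordinate set \<Rightarrow> (real \<Rightarrow> 'p) \<Rightarrow> bool" where
  "closed_differentiable_curve X \<A> C \<longleftrightarrow>
     pathin X C \<and> C 1 = C 0 \<and>
     (\<forall>t\<in>{0..1}. \<forall>c\<in>\<A>. C t \<in> fst c \<longrightarrow> (snd c \<circ> C) differentiable (at t within {0..1}))"

text \<open>
  \<open>\<omega> i\<close> is the local representing function of a differential \<open>\<omega> i dz\<^sub>i\<close>; the function \<open>h\<close>
  below is its pullback to the parameter interval, which has to come out the same in all
  coordinates around \<open>C t\<close>.
\<close>

definition has_curve_integral ::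
  "('i, 'p) hol_bundle \<Rightarrow> 'i lsection \<Rightarrow> (real \<Rightarrow> 'p) \<Rightarrow> complex \<Rightarrow> bool" where
  "has_curve_integral L \<omega> C v \<longleftrightarrow>
     (\<exists>h. (\<forall>t\<in>{0..1}. \<forall>i\<in>index L. C t \<in> patch L i \<longrightarrow>
              h t = \<omega> i (z_of L i (C t)) * vector_derivative (z_of L i \<circ> C) (at t within {0..1})) \<and>
          (h has_integral v) {0..1})"

definition curve_integral :: "('i, 'p) hol_bundle \<Rightarrow> (real \<Rightarrow> 'p) \<Rightarrow> 'i lsection \<Rightarrow> complex" where
  "curve_integral L C \<omega> = (THE v. has_curve_integral L \<omega> C v)"


section \<open>The bilinear form\<close>

definition even_integrand ::
  "('i, 'p) hol_bundle \<Rightarrow> 'p coordinate set \<Rightarrow> ('p coordinate \<Rightarrow> complex \<Rightarrow> complex) \<Rightarrow>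
     'i lsection \<Rightarrow> 'i lsection \<Rightarrow> 'i lsection" where
  "even_integrand L \<V> R e f = (\<lambda>i x.
     1/2 * ((deriv ^^ 3) (e i) x * f i x - e i x * (deriv ^^ 3) (f i) x)
     - pc_rep \<V> R (coord L i) x * (deriv (e i) x * f i x - e i x * deriv (f i) x))"

definition odd_integrand ::
  "('i, 'p) hol_bundle \<Rightarrow> 'p coordinate set \<Rightarrow> ('p coordinate \<Rightarrow> complex \<Rightarrow> complex) \<Rightarrow>
     'i lsection \<Rightarrow> 'i lsection \<Rightarrow> 'i lsection" where
  "odd_integrand L \<V> R \<phi> \<psi> = (\<lambda>i x.
     (deriv ^^ 2) (\<phi> i) x * \<psi> i x + \<phi> i x * (deriv ^^ 2) (\<psi> i) x
     - pc_rep \<V> R (coord L i) x * \<phi> i x * \<psi> i x)"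

definition Phi_even ::
  "('i, 'p) hol_bundle \<Rightarrow> (real \<Rightarrow> 'p) \<Rightarrow> 'p coordinate set \<Rightarrow> ('p coordinate \<Rightarrow> complex \<Rightarrow> complex) \<Rightarrow>
     'i lsection \<Rightarrow> 'i lsection \<Rightarrow> complex" where
  "Phi_even L C \<V> R e f =
     1 / (24 * of_real pi * \<i>) * curve_integral L C (even_integrand L \<V> R e f)"

definition Phi_odd ::
  "('i, 'p) hol_bundle \<Rightarrow> (real \<Rightarrow> 'p) \<Rightarrow> 'p coordinate set \<Rightarrow> ('p coordinate \<Rightarrow> complex \<Rightarrow> complex) \<Rightarrow>
     'i lsection \<Rightarrow> 'i lsection \<Rightarrow> complex" where
  "Phi_odd L C \<V> R \<phi> \<psi> =
     - (1 / (24 * of_real pi * \<i>)) * curve_integral L C (odd_integrand L \<V> R \<phi> \<psi>)"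

text \<open>The bilinear extension; the mixed terms \<open>\<Phi>(e, \<psi>)\<close> and \<open>\<Phi>(\<phi>, f)\<close> are 0.\<close>

definition Phi ::
  "('i, 'p) hol_bundle \<Rightarrow> (real \<Rightarrow> 'p) \<Rightarrow> 'p coordinate set \<Rightarrow> ('p coordinate \<Rightarrow> complex \<Rightarrow> complex) \<Rightarrow>
     'i lsection \<times> 'i lsection \<Rightarrow> 'i lsection \<times> 'i lsection \<Rightarrow> complex" where
  "Phi L C \<V> R = (\<lambda>(e, \<phi>) (f, \<psi>). Phi_even L C \<V> R e f + Phi_odd L C \<V> R \<phi> \<psi>)"

end

theory Submission
  imports Defs
begin

text \<open>
  The form is a cocycle because its integrands are differentials on the surface, and because in every
  instance of the cocycle identity the sum of the integrands is the derivative of a function on the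
  surface outside \<open>A\<close>. The integral of such a derivative along a closed curve is 0.

  Over the overlap of two frames of \<open>L\<close>, the coordinate change \<open>f\<close> has the derivative \<open>f' = h\<^sup>2\<close>, where
  \<open>h\<close> is the inverse of the transition function. Vector fields and spinors, that is, sections of
  \<open>\<K>\<^bsup>-1\<^esup>\<close> and \<open>\<K>\<^bsup>-1/2\<^esup>\<close>, satisfy \<open>u (f y) = (h y)\<^sup>2 e y\<close> and \<open>v (f y) = h y p y\<close>. Differentiating these
  identities repeatedly gives the behaviour of all derivatives in terms of \<open>a = h'/h\<close>
  (\<open>vector_field_jet\<close>, \<open>spinor_jet\<close>). The correction terms that spoil the invariance of
  \<open>e'''f - e f'''\<close> and \<open>p''q + p q''\<close> are multiples of \<open>2 a' - 2 a\<^sup>2\<close>. This is the Schwarzian derivative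
  of \<open>f\<close> (\<open>schwarzian_f\<close>), so the inhomogeneous transformation law of the projective connection removes
  them (\<open>even_form_differential\<close>, \<open>odd_form_differential\<close>).

  As the form vanishes on elements of different parity, the cocycle identity has content for three
  vector fields \<open>e, f, g\<close> and for a vector field \<open>e\<close> with two spinors \<open>p, q\<close>. In both cases the terms
  with the projective connection cancel. In the first case the sum is \<open>-1/2\<close> times the derivative of
  the Wronskian determinant of \<open>e, f, g\<close> (\<open>even_cocycle_exact\<close>). In the second it is the derivative of
  \<open>-1/2 e''pq + 1/2 e'(pq)' + 1/2 e(p''q + pq'') - e p'q'\<close> (\<open>mixed_cocycle_exact\<close>). Both expressions take
  the same value in all frames, hence are functions on the surface (\<open>wronskian_invariant\<close>,
  \<open>transvectant_invariant\<close>).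

  The curve is differentiable but not necessarily continuously so; therefore the integrals are
  handled through primitives (\<open>pull_integrable\<close>, \<open>curve_integral_exact\<close>). The passage from the cocycle to
  the central extension is valid for every Lie superalgebra (\<open>cocycle_central_extension\<close>), and the axioms
  of a Lie superalgebra for vector fields and spinors are identities between derivatives at a
  point (\<open>KN_lie_superalgebra\<close>).
\<close>

section \<open>Central extensions from cocycles\<close>

lemma bilinear_map_on_zero:
  fixes b :: "'v::ab_group_add \<Rightarrow> 'v \<Rightarrow> 'w::ab_group_add"
  assumes "bilinear_map_on s s' V b" "0 \<in> V" "x \<in> V"
  shows "b 0 x = 0" "b x 0 = 0"
proof -
  have "b (0 + 0) x = b 0 x + b 0 x" "b x (0 + 0) = b x 0 + b x 0"
    using assms unfolding bilinear_map_on_def by blast+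
  then show "b 0 x = 0" "b x 0 = 0" by simp_all
qed

lemma zero_in_part:
  assumes "is_superspace A" "p \<in> {0, 1}"
  shows "0 \<in> part A p"
proof -
  have m: "module (scl A)"
    using assms(1) unfolding is_superspace_def by (simp add: module_iff_vector_space)
  then show ?thesis
    using assms module.subspace_def[OF m] unfolding is_superspace_def by blast
qed

lemma part_in_total:
  assumes "is_superspace A" "p \<in> {0, 1}" "x \<in> part A p"
  shows "x \<in> total A"
proof (cases "p = 0")
  case True
  then have "x = x + 0 \<and> x \<in> part A 0 \<and> 0 \<in> part A 1"
    using assms zero_in_part[of A 1] by simp
  then show ?thesis unfolding total_def by blast
next
  case False
  then have "x = 0 + x \<and> 0 \<in> part A 0 \<and> x \<in> part A 1"
    using assms zero_in_part[of A 0] by simp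
  then show ?thesis unfolding total_def by blast
qed

lemma total_extension: "total (extension A c) = UNIV \<times> total A"
  unfolding total_def extension_def by force

lemma is_superspace_extension:
  assumes "is_superspace A"
  shows "is_superspace (extension A c)"
proof -
  have v: "vector_space (scl A)" and s0: "module.subspace (scl A) (part A 0)"
    and s1: "module.subspace (scl A) (part A 1)" and i: "part A 0 \<inter> part A 1 = {0}"
    using assms unfolding is_superspace_def by auto
  have m: "module (scl A)"
    using v by (simp add: module_iff_vector_space)
  have v': "vector_space (scl (extension A c))"
    using v unfolding vector_space_def extension_def by (auto simp: algebra_simps)
  have m': "module (scl (extension A c))"
    using v' by (simp add: module_iff_vector_space)
  have "module.subspace (scl (extension A c)) (part (extension A c) 0)"
       "module.subspace (scl (extension A c)) (part (extension A c) 1)"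
    using s0 s1 unfolding module.subspace_def[OF m] module.subspace_def[OF m']
    by (auto simp: extension_def zero_prod_def)
  with v' i show ?thesis
    unfolding is_superspace_def by (auto simp: extension_def zero_prod_def)
qed

text \<open>The \<open>t\<close>-component of each axiom for the extension is the corresponding property of \<open>c\<close>;
  that \<open>c\<close> vanishes on pairs of different parity is what makes the extended bracket even.\<close>

lemma lie_superalgebra_extension:
  assumes A: "lie_superalgebra A" and c: "even_super_cocycle A c"
  shows "lie_superalgebra (extension A c)"
proof -
  have sup: "is_superspace A" and bil: "bilinear_map_on (scl A) (scl A) (total A) (brk A)"
    and cl: "\<And>p q x y. p \<in> {0,1} \<Longrightarrow> q \<in> {0,1} \<Longrightarrow> x \<in> part A p \<Longrightarrow> y \<in> part A q \<Longrightarrow>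
        brk A x y \<in> part A ((p + q) mod 2) \<and>
        brk A x y = scl A (- ((-1) ^ (p * q))) (brk A y x)"
    and jac: "\<And>p q r x y z. p \<in> {0,1} \<Longrightarrow> q \<in> {0,1} \<Longrightarrow> r \<in> {0,1} \<Longrightarrow>
        x \<in> part A p \<Longrightarrow> y \<in> part A q \<Longrightarrow> z \<in> part A r \<Longrightarrow>
        scl A ((-1) ^ (p * r)) (brk A x (brk A y z)) +
        scl A ((-1) ^ (q * p)) (brk A y (brk A z x)) +
        scl A ((-1) ^ (r * q)) (brk A z (brk A x y)) = 0"
    using A unfolding lie_superalgebra_def by blast+
  have cbil: "bilinear_map_on (scl A) (*) (total A) c"
    and cmix: "\<And>x y. x \<in> part A 0 \<Longrightarrow> y \<in> part A 1 \<Longrightarrow> c x y = 0 \<and> c y x = 0"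
    and csym: "\<And>p q x y. p \<in> {0,1} \<Longrightarrow> q \<in> {0,1} \<Longrightarrow> x \<in> part A p \<Longrightarrow> y \<in> part A q \<Longrightarrow>
        c x y = - ((-1) ^ (p * q)) * c y x"
    and cjac: "\<And>p q r x y z. p \<in> {0,1} \<Longrightarrow> q \<in> {0,1} \<Longrightarrow> r \<in> {0,1} \<Longrightarrow>
        x \<in> part A p \<Longrightarrow> y \<in> part A q \<Longrightarrow> z \<in> part A r \<Longrightarrow>
        (-1) ^ (p * r) * c x (brk A y z) +
        (-1) ^ (q * p) * c y (brk A z x) +
        (-1) ^ (r * q) * c z (brk A x y) = 0"
    using c unfolding even_super_cocycle_def by blast+
  let ?B = "extension A c"
  have s: "scl ?B a (b, x) = (a * b, scl A a x)" for a b x by (simp add: extension_def)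
  have k: "brk ?B (a, x) (b, y) = (c x y, brk A x y)" for a b x y by (simp add: extension_def)
  have P: "(a, x) \<in> part ?B p \<longleftrightarrow> (p = 0 \<or> a = 0) \<and> x \<in> part A p" for a x p
    by (auto simp: extension_def)
  have 0: "bilinear_map_on (scl ?B) (scl ?B) (total ?B) (brk ?B)"
    using bil cbil unfolding bilinear_map_on_def total_extension
    by (auto simp: s k)
  have 1: "brk ?B x y \<in> part ?B ((p + q) mod 2) \<and>
        brk ?B x y = scl ?B (- ((-1) ^ (p * q))) (brk ?B y x)"
    if pq: "p \<in> {0,1}" "q \<in> {0,1}" and xy: "x \<in> part ?B p" "y \<in> part ?B q" for p q x y
  proof -
    obtain a x' where x: "x = (a, x')" by fastforce
    obtain b y' where y: "y = (b, y')" by fastforce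
    have x': "x' \<in> part A p" and y': "y' \<in> part A q" using xy unfolding x y P by auto
    have "(p + q) mod 2 = 0 \<or> c x' y' = 0"
      using pq x' y' cmix by auto
    then show ?thesis
      unfolding x y k s P prod.inject using cl[OF pq x' y'] csym[OF pq x' y'] by blast
  qed
  have 2: "scl ?B ((-1) ^ (p * r)) (brk ?B x (brk ?B y z)) +
        scl ?B ((-1) ^ (q * p)) (brk ?B y (brk ?B z x)) +
        scl ?B ((-1) ^ (r * q)) (brk ?B z (brk ?B x y)) = 0"
    if pqr: "p \<in> {0,1}" "q \<in> {0,1}" "r \<in> {0,1}"
      and xyz: "x \<in> part ?B p" "y \<in> part ?B q" "z \<in> part ?B r" for p q r x y z
  proof -
    obtain a x' where x: "x = (a, x')" by fastforce
    obtain b y' where y: "y = (b, y')" by fastforce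
    obtain d z' where z: "z = (d, z')" by fastforce
    have x': "x' \<in> part A p" and y': "y' \<in> part A q" and z': "z' \<in> part A r"
      using xyz unfolding x y z P by auto
    show ?thesis
      unfolding x y z k s zero_prod_def add_Pair prod.inject
      using cjac[OF pqr x' y' z'] jac[OF pqr x' y' z'] by blast
  qed
  show ?thesis
    unfolding lie_superalgebra_def
  proof (intro conjI)
    show "is_superspace ?B" using is_superspace_extension[OF sup] .
  qed (intro ballI 0 1 2; assumption)+
qed

proposition cocycle_central_extension:
  assumes A: "lie_superalgebra A" and c: "even_super_cocycle A c"
  shows "is_central_extension (extension A c) (1, 0) snd A"
proof -
  have sup: "is_superspace A" and bil: "bilinear_map_on (scl A) (scl A) (total A) (brk A)"
    using A unfolding lie_superalgebra_def by blast+
  have cbil: "bilinear_map_on (scl A) (*) (total A) c"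
    using c unfolding even_super_cocycle_def by blast
  have z: "0 \<in> part A 0" "0 \<in> total A"
    using zero_in_part[OF sup, of 0] part_in_total[OF sup, of 0] by auto
  have m: "module (scl A)"
    using sup unfolding is_superspace_def by (simp add: module_iff_vector_space)
  have s0: "scl A a 0 = 0" for a using module.scale_zero_right[OF m] .
  let ?B = "extension A c"
  have s: "scl ?B a (b, x) = (a * b, scl A a x)" for a b x by (simp add: extension_def)
  have k: "brk ?B (a, x) (b, y) = (c x y, brk A x y)" for a b x y by (simp add: extension_def)
  have "\<forall>x\<in>total ?B. brk ?B (1, 0) x = 0 \<and> brk ?B x (1, 0) = 0"
    using bilinear_map_on_zero[OF bil z(2)] bilinear_map_on_zero[OF cbil z(2)]
    by (auto simp: k total_extension zero_prod_def)
  moreover have "snd ` part ?B p = part A p" for p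
    by (force simp: extension_def)
  moreover have "{x \<in> total ?B. snd x = 0} = range (\<lambda>a. scl ?B a (1, 0))"
    using z by (auto simp: total_extension s s0 image_iff)
  moreover have "(1, 0) \<in> part ?B 0" using z by (simp add: extension_def)
  ultimately show ?thesis
    unfolding is_central_extension_def
    using A lie_superalgebra_extension[OF A c]
    by (auto simp: s k zero_prod_def)
qed

section \<open>Derivatives of vector fields and spinors under a coordinate change\<close>

text \<open>Differentiating an identity between holomorphic functions. All the transformation laws below
  arise from \<open>u (f y) = (h y)\<^sup>k * e y\<close> by repeated use of this rule, which needs the identity on an
  open set and not only at the point of interest.\<close>

lemma deriv_unique_on_open:
  fixes F G :: "complex \<Rightarrow> complex"
  assumes "open S" "x \<in> S" "\<And>y. y \<in> S \<Longrightarrow> F y = G y"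
    "(F has_field_derivative F') (at x)" "(G has_field_derivative G') (at x)"
  shows "F' = G'"
  using DERIV_unique has_field_derivative_transform_within_open[OF assms(4,1,2,3)] assms(5)
  by blast

lemma higher_deriv_numeral:
  "(deriv ^^ 2) f = deriv (deriv f)" "(deriv ^^ 3) f = deriv (deriv (deriv f))"
  by (simp_all add: numeral_2_eq_2 numeral_3_eq_3)

lemma holomorphic_jet:
  assumes "f holomorphic_on S" "open S" "x \<in> S"
  shows "(f has_field_derivative deriv f x) (at x)"
    "(deriv f has_field_derivative deriv (deriv f) x) (at x)"
    "(deriv (deriv f) has_field_derivative deriv (deriv (deriv f)) x) (at x)"
    "(deriv (deriv (deriv f)) has_field_derivative deriv (deriv (deriv (deriv f))) x) (at x)"
  using assms by (auto intro!: holomorphic_derivI holomorphic_deriv)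

text \<open>The local model of a coordinate change \<open>f\<close> together with the transition function of a theta
  characteristic: \<open>h\<close> is a square root of \<open>f'\<close>, and vector fields and spinors transform by
  \<open>h\<^sup>2\<close> and \<open>h\<close>. Everything is expressed through the logarithmic derivative of \<open>h\<close>, so that
  the correction terms become polynomials in its derivatives.\<close>

locale half_jacobian =
  fixes S T :: "complex set" and f h :: "complex \<Rightarrow> complex"
  assumes open_S: "open S" and open_T: "open T"
    and f_holo: "f holomorphic_on S" and f_img: "f ` S \<subseteq> T"
    and h_holo: "h holomorphic_on S"
    and deriv_f: "\<And>y. y \<in> S \<Longrightarrow> deriv f y = (h y)\<^sup>2"
    and h_nz: "\<And>y. y \<in> S \<Longrightarrow> h y \<noteq> 0"
begin

definition dlog :: "complex \<Rightarrow> complex" where "dlog y = deriv h y / h y"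

lemma deriv_h: "y \<in> S \<Longrightarrow> deriv h y = dlog y * h y"
  using h_nz by (simp add: dlog_def)

lemma dlog_holo: "dlog holomorphic_on S"
  unfolding dlog_def by (intro holomorphic_intros h_holo open_S h_nz)

lemma compose_jet:
  assumes u: "u holomorphic_on T" and y: "y \<in> S"
  shows "((\<lambda>y. u (f y)) has_field_derivative deriv u (f y) * (h y)\<^sup>2) (at y)"
proof -
  have "(u has_field_derivative deriv u (f y)) (at (f y))"
    using u open_T f_img y by (auto intro: holomorphic_derivI)
  moreover have "(f has_field_derivative (h y)\<^sup>2) (at y)"
    using holomorphic_derivI[OF f_holo open_S y] deriv_f[OF y] by simp
  ultimately show ?thesis by (rule DERIV_chain2)
qed

lemma h_jet: "y \<in> S \<Longrightarrow> (h has_field_derivative dlog y * h y) (at y)"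
  using holomorphic_derivI[OF h_holo open_S] deriv_h by metis

text \<open>With \<open>f' = h\<^sup>2\<close> one has \<open>f''/f' = 2 h'/h\<close>, and the Schwarzian derivative is
  \<open>(f''/f')' - (f''/f')\<^sup>2 / 2\<close>.\<close>

lemma schwarzian_f:
  assumes y: "y \<in> S"
  shows "schwarzian f y = 2 * deriv dlog y - 2 * (dlog y)\<^sup>2"
proof -
  note fj = holomorphic_jet[OF f_holo open_S] and aj = holomorphic_jet[OF dlog_holo open_S]
  have 2: "deriv (deriv f) y = 2 * dlog y * (h y)\<^sup>2" if y: "y \<in> S" for y
    by (rule deriv_unique_on_open[OF open_S y deriv_f fj(2)[OF y]])
       (auto intro!: derivative_eq_intros h_jet y simp: power2_eq_square)
  have 3: "deriv (deriv (deriv f)) y = 2 * deriv dlog y * (h y)\<^sup>2 + 4 * (dlog y)\<^sup>2 * (h y)\<^sup>2"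
    by (rule deriv_unique_on_open[OF open_S y 2 fj(3)[OF y]])
       (auto intro!: derivative_eq_intros h_jet aj y simp: power2_eq_square)
  show ?thesis
    using h_nz[OF y] unfolding schwarzian_def higher_deriv_numeral 3 2[OF y] deriv_f[OF y]
    by (simp add: field_simps power2_eq_square)
qed

text \<open>The powers of \<open>h\<close> are kept on the left so that, after the first, each formula follows
  from the preceding one by differentiation, without any division. The coefficient of \<open>e'\<close> in the third formula is twice the
  Schwarzian derivative of \<open>f\<close>; this is the term that a projective connection compensates.\<close>

lemma vector_field_jet:
  assumes u: "u holomorphic_on T" and e: "e holomorphic_on S"
    and ue: "\<And>y. y \<in> S \<Longrightarrow> u (f y) = (h y)\<^sup>2 * e y" and y: "y \<in> S"
  shows "deriv u (f y) = deriv e y + 2 * dlog y * e y"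
    "deriv (deriv u) (f y) * (h y)\<^sup>2 = deriv (deriv e) y + 2 * dlog y * deriv e y + 2 * deriv dlog y * e y"
    "deriv (deriv (deriv u)) (f y) * (h y) ^ 4 =
       deriv (deriv (deriv e)) y + 4 * (deriv dlog y - (dlog y)\<^sup>2) * deriv e y +
       (2 * deriv (deriv dlog) y - 4 * dlog y * deriv dlog y) * e y"
proof -
  note ej = holomorphic_jet[OF e open_S] and aj = holomorphic_jet[OF dlog_holo open_S]
  note u1 = holomorphic_deriv[OF u open_T]
  note u2 = holomorphic_deriv[OF u1 open_T]
  have 1: "deriv u (f y) = deriv e y + 2 * dlog y * e y" if y: "y \<in> S" for y
  proof -
    have "deriv u (f y) * (h y)\<^sup>2 = 2 * dlog y * (h y)\<^sup>2 * e y + (h y)\<^sup>2 * deriv e y"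
      by (rule deriv_unique_on_open[OF open_S y ue compose_jet[OF u y]])
         (auto intro!: derivative_eq_intros h_jet ej y simp: power2_eq_square)
    then have "deriv u (f y) * (h y)\<^sup>2 = (deriv e y + 2 * dlog y * e y) * (h y)\<^sup>2"
      by (simp add: algebra_simps)
    then show ?thesis using h_nz[OF y] by simp
  qed
  show "deriv u (f y) = deriv e y + 2 * dlog y * e y" using 1 y .
  have 2: "deriv (deriv u) (f y) * (h y)\<^sup>2 =
      deriv (deriv e) y + 2 * dlog y * deriv e y + 2 * deriv dlog y * e y" if y: "y \<in> S" for y
    by (rule deriv_unique_on_open[OF open_S y 1 compose_jet[OF u1 y]])
       (auto intro!: derivative_eq_intros ej aj y simp: algebra_simps)
  show "deriv (deriv u) (f y) * (h y)\<^sup>2 =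
      deriv (deriv e) y + 2 * dlog y * deriv e y + 2 * deriv dlog y * e y" using 2 y .
  have "deriv (deriv (deriv u)) (f y) * (h y)\<^sup>2 * (h y)\<^sup>2
      + deriv (deriv u) (f y) * (2 * dlog y * (h y)\<^sup>2) =
      deriv (deriv (deriv e)) y + 2 * dlog y * deriv (deriv e) y + 4 * deriv dlog y * deriv e y
      + 2 * deriv (deriv dlog) y * e y"
    by (rule deriv_unique_on_open[OF open_S y 2])
       (auto intro!: derivative_eq_intros compose_jet[OF u2] h_jet ej aj y
         simp: algebra_simps power2_eq_square)
  then show "deriv (deriv (deriv u)) (f y) * (h y) ^ 4 =
       deriv (deriv (deriv e)) y + 4 * (deriv dlog y - (dlog y)\<^sup>2) * deriv e y +
       (2 * deriv (deriv dlog) y - 4 * dlog y * deriv dlog y) * e y"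
    using 2[OF y] by algebra
qed

text \<open>A function of weight \<open>-1/2\<close> is the one case in which the second derivative involves no first
  derivative: its correction term is half the Schwarzian derivative times \<open>p\<close>.\<close>

lemma spinor_jet:
  assumes v: "v holomorphic_on T" and p: "p holomorphic_on S"
    and vp: "\<And>y. y \<in> S \<Longrightarrow> v (f y) = h y * p y" and y: "y \<in> S"
  shows "deriv v (f y) * h y = deriv p y + dlog y * p y"
    "deriv (deriv v) (f y) * (h y) ^ 3 = deriv (deriv p) y + (deriv dlog y - (dlog y)\<^sup>2) * p y"
proof -
  note pj = holomorphic_jet[OF p open_S] and aj = holomorphic_jet[OF dlog_holo open_S]
  note v1 = holomorphic_deriv[OF v open_T]
  have 1: "deriv v (f y) * h y = deriv p y + dlog y * p y" if y: "y \<in> S" for y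
  proof -
    have "deriv v (f y) * (h y)\<^sup>2 = dlog y * h y * p y + h y * deriv p y"
      by (rule deriv_unique_on_open[OF open_S y vp compose_jet[OF v y]])
         (auto intro!: derivative_eq_intros h_jet pj y)
    then have "deriv v (f y) * h y * h y = (deriv p y + dlog y * p y) * h y"
      by (simp add: algebra_simps power2_eq_square)
    then show ?thesis using h_nz[OF y] by simp
  qed
  show "deriv v (f y) * h y = deriv p y + dlog y * p y" using 1 y .
  have "deriv (deriv v) (f y) * (h y)\<^sup>2 * h y + deriv v (f y) * (dlog y * h y) =
      deriv (deriv p) y + dlog y * deriv p y + deriv dlog y * p y"
    by (rule deriv_unique_on_open[OF open_S y 1])
       (auto intro!: derivative_eq_intros compose_jet[OF v1] h_jet pj aj y simp: algebra_simps)
  then show "deriv (deriv v) (f y) * (h y) ^ 3 = deriv (deriv p) y + (deriv dlog y - (dlog y)\<^sup>2) * p y"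
    using 1[OF y] by algebra
qed

end

section \<open>Coordinate changes and projective connections\<close>

lemma chart_subset: "is_chart X c \<Longrightarrow> fst c \<subseteq> topspace X"
  unfolding is_chart_def by (blast dest: openin_subset)

lemma chart_inj: "is_chart X c \<Longrightarrow> inj_on (snd c) (fst c)"
  using chart_subset unfolding is_chart_def homeomorphic_eq_everything_map
  by (fastforce simp: topspace_subtopology Int_absorb1)

lemma chart_open_image:
  assumes "is_chart X c" "openin X W" "W \<subseteq> fst c"
  shows "open (snd c ` W)"
proof -
  have "open_map (subtopology X (fst c)) (top_of_set (snd c ` fst c)) (snd c)"
    using assms(1) unfolding is_chart_def by (blast intro: homeomorphic_imp_open_map)
  moreover have "openin (subtopology X (fst c)) W"
    using assms unfolding is_chart_def by (simp add: openin_open_subtopology)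
  ultimately have "openin (top_of_set (snd c ` fst c)) (snd c ` W)"
    unfolding open_map_def by blast
  then show ?thesis
    using assms(1) unfolding is_chart_def by (blast intro: openin_open_trans)
qed

lemma point_at_chart [simp]:
  "is_chart X c \<Longrightarrow> p \<in> fst c \<Longrightarrow> point_at c (snd c p) = p"
  unfolding point_at_def by (simp add: chart_inj inv_into_f_f)

lemma change_chart [simp]:
  "is_chart X c \<Longrightarrow> p \<in> fst c \<Longrightarrow> change c d (snd c p) = snd d p"
  unfolding change_def by simp

lemma open_overlap:
  assumes "is_chart X c" "is_chart X d"
  shows "open (overlap c d)"
  unfolding overlap_def using assms
  by (intro chart_open_image) (auto simp: is_chart_def)

lemma overlapE:
  assumes "x \<in> overlap c d"
  obtains p where "p \<in> fst c" "p \<in> fst d" "x = snd c p"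
  using assms unfolding overlap_def by blast

lemma holomorphic_on_locally:
  assumes "\<And>x. x \<in> S \<Longrightarrow> \<exists>T g. open T \<and> x \<in> T \<and> g holomorphic_on T \<and> (\<forall>y\<in>T. f y = g y)"
  shows "f holomorphic_on S"
  unfolding holomorphic_on_def
proof
  fix x assume "x \<in> S"
  then obtain T g where T: "open T" "x \<in> T" "g holomorphic_on T" "\<forall>y\<in>T. f y = g y"
    using assms by blast
  then have "f holomorphic_on T" by (metis holomorphic_transform)
  then have "f field_differentiable (at x)"
    using T holomorphic_on_imp_differentiable_at by blast
  then show "f field_differentiable (at x within S)"
    by (rule field_differentiable_at_within)
qed

text \<open>The cocycle property of the Schwarzian derivative, which makes projective connections
  meaningful in coordinates outside their defining covering.\<close>

lemma schwarzian_compose: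
  assumes S: "open S" "x \<in> S" and T: "open T" and f: "f holomorphic_on S" "f ` S \<subseteq> T"
    and k: "k holomorphic_on T" and g: "\<And>y. y \<in> S \<Longrightarrow> g y = k (f y)"
    and nz: "deriv f x \<noteq> 0" "deriv k (f x) \<noteq> 0"
  shows "schwarzian g x = schwarzian k (f x) * (deriv f x)\<^sup>2 + schwarzian f x"
proof -
  note fj = holomorphic_jet[OF f(1) S(1)]
  have fT: "f y \<in> T" if "y \<in> S" for y using f(2) that by blast
  have kf: "((\<lambda>y. (u (f y))) has_field_derivative deriv u (f y) * deriv f y) (at y)"
    if "u holomorphic_on T" "y \<in> S" for u y
    using DERIV_chain2[OF holomorphic_derivI[OF that(1) T fT[OF that(2)]] fj(1)[OF that(2)]] .
  note k1 = holomorphic_deriv[OF k T]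
  note k2 = holomorphic_deriv[OF k1 T]
  have g': "g holomorphic_on S"
  proof (rule holomorphic_transform)
    show "(\<lambda>y. k (f y)) holomorphic_on S"
      using holomorphic_on_compose_gen[OF f(1) k f(2)] by (simp add: o_def)
  qed (simp add: g)
  note gj = holomorphic_jet[OF g' S(1)]
  have 1: "deriv g y = deriv k (f y) * deriv f y" if y: "y \<in> S" for y
    by (rule deriv_unique_on_open[OF S(1) y g gj(1)[OF y] kf[OF k y]])
  have 2: "deriv (deriv g) y =
      deriv (deriv k) (f y) * (deriv f y)\<^sup>2 + deriv k (f y) * deriv (deriv f) y"
    if y: "y \<in> S" for y
    by (rule deriv_unique_on_open[OF S(1) y 1 gj(2)[OF y]])
       (auto intro!: derivative_eq_intros kf[OF k1] fj y simp: power2_eq_square)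
  have 3: "deriv (deriv (deriv g)) x = deriv (deriv (deriv k)) (f x) * (deriv f x) ^ 3 +
      3 * deriv (deriv k) (f x) * deriv f x * deriv (deriv f) x +
      deriv k (f x) * deriv (deriv (deriv f)) x"
    by (rule deriv_unique_on_open[OF S(1) S(2) 2 gj(3)[OF S(2)]])
       (auto intro!: derivative_eq_intros kf[OF k1] kf[OF k2] fj S(2)
         simp: algebra_simps power2_eq_square power3_eq_cube)
  show ?thesis
    unfolding schwarzian_def higher_deriv_numeral 1[OF S(2)] 2[OF S(2)] 3
    using nz by (simp add: field_simps power2_eq_square power3_eq_cube)
qed

locale riemann_surface_charts =
  fixes X :: "'p topology" and \<A> :: "'p coordinate set"
  assumes surface: "riemann_surface X \<A>"
begin

abbreviation hol_coord :: "'p coordinate \<Rightarrow> bool" where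
  "hol_coord \<equiv> holomorphic_coordinate X \<A>"

lemma hol_coord_chart: "hol_coord c \<Longrightarrow> is_chart X c"
  unfolding holomorphic_coordinate_def by blast

lemma atlas_hol_coord: "c \<in> \<A> \<Longrightarrow> hol_coord c"
  using surface unfolding riemann_surface_def holomorphic_coordinate_def by blast

lemma atlas_covers:
  assumes "p \<in> topspace X" obtains c where "c \<in> \<A>" "p \<in> fst c"
  using surface assms unfolding riemann_surface_def by blast

lemma open_chart_image:
  "hol_coord c \<Longrightarrow> openin X W \<Longrightarrow> W \<subseteq> fst c \<Longrightarrow> open (snd c ` W)"
  using chart_open_image hol_coord_chart by blast

lemma open_patch: "hol_coord c \<Longrightarrow> openin X (fst c)"
  using hol_coord_chart is_chart_def by blast

text \<open>Two holomorphic coordinates are only required to be compatible with the atlas. Near each point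
  their coordinate change factors through a chart of the atlas.\<close>

lemma change_holomorphic:
  assumes c: "hol_coord c" and d: "hol_coord d"
  shows "change c d holomorphic_on overlap c d"
proof (rule holomorphic_on_locally)
  fix x assume "x \<in> overlap c d"
  then obtain p where p: "p \<in> fst c" "p \<in> fst d" "x = snd c p" by (rule overlapE)
  have "p \<in> topspace X" using p chart_subset hol_coord_chart c by blast
  then obtain a where a: "a \<in> \<A>" "p \<in> fst a" by (rule atlas_covers)
  then have ac: "hol_coord a" using atlas_hol_coord by blast
  define W where "W = fst c \<inter> fst d \<inter> fst a"
  have "openin X W"
    unfolding W_def by (intro openin_Int open_patch c d ac)
  then have op: "open (snd c ` W)"
    by (rule open_chart_image[OF c]) (auto simp: W_def)
  have "change c a holomorphic_on snd c ` W"
    using c a(1) unfolding holomorphic_coordinate_def compatible_def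
    by (elim conjE ballE[where x = a])
       (auto simp: W_def overlap_def elim!: holomorphic_on_subset)
  moreover have "change a d holomorphic_on snd a ` W"
    using d a(1) unfolding holomorphic_coordinate_def compatible_def
    by (elim conjE ballE[where x = a])
       (auto simp: W_def overlap_def elim!: holomorphic_on_subset)
  moreover have "change c a ` snd c ` W \<subseteq> snd a ` W"
    using hol_coord_chart[OF c] by (auto simp: W_def change_chart[of X])
  ultimately have "change a d \<circ> change c a holomorphic_on snd c ` W"
    by (rule holomorphic_on_compose_gen)
  moreover have "\<forall>y\<in>snd c ` W. change c d y = (change a d \<circ> change c a) y"
    using hol_coord_chart[OF c] hol_coord_chart[OF ac] by (auto simp: W_def change_chart[of X])
  moreover have "x \<in> snd c ` W" using p a by (auto simp: W_def)
  ultimately show "\<exists>T g. open T \<and> x \<in> T \<and> g holomorphic_on T \<and> (\<forall>y\<in>T. change c d y = g y)"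
    using op by blast
qed

text \<open>The inverse coordinate change is holomorphic as well.\<close>

lemma deriv_change_nonzero:
  assumes c: "hol_coord c" and d: "hol_coord d" and x: "x \<in> overlap c d"
  shows "deriv (change c d) x \<noteq> 0"
proof -
  note cc = hol_coord_chart[OF c] and dd = hol_coord_chart[OF d]
  have x': "change c d x \<in> overlap d c"
    using x cc by (auto simp: overlap_def change_chart[of X])
  have "((\<lambda>y. change d c (change c d y)) has_field_derivative
      deriv (change d c) (change c d x) * deriv (change c d) x) (at x)"
    using DERIV_chain2[OF holomorphic_derivI[OF change_holomorphic[OF d c] open_overlap[OF dd cc] x']
        holomorphic_derivI[OF change_holomorphic[OF c d] open_overlap[OF cc dd] x]] .
  moreover have inv: "change d c (change c d y) = y" if "y \<in> overlap c d" for y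
    using that cc dd by (auto simp: overlap_def change_chart[of X])
  ultimately have "deriv (change d c) (change c d x) * deriv (change c d) x = 1"
    using deriv_unique_on_open[OF open_overlap[OF cc dd] x inv _ DERIV_ident] by simp
  then show ?thesis by auto
qed

lemma change_chain:
  assumes c: "hol_coord c" and d: "hol_coord d" and e: "hol_coord e"
    and p: "p \<in> fst c" "p \<in> fst d" "p \<in> fst e"
  shows "deriv (change c e) (snd c p) = deriv (change d e) (snd d p) * deriv (change c d) (snd c p)"
    and "schwarzian (change c e) (snd c p) =
      schwarzian (change d e) (snd d p) * (deriv (change c d) (snd c p))\<^sup>2
      + schwarzian (change c d) (snd c p)"
proof -
  note cc = hol_coord_chart[OF c] and dd = hol_coord_chart[OF d] and ee = hol_coord_chart[OF e]
  define W where "W = fst c \<inter> fst d \<inter> fst e"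
  have "openin X W"
    unfolding W_def by (intro openin_Int open_patch c d e)
  then have op: "open (snd c ` W)"
    by (rule open_chart_image[OF c]) (auto simp: W_def)
  have pW: "snd c p \<in> snd c ` W" using p by (auto simp: W_def)
  have f: "change c d holomorphic_on snd c ` W"
    by (rule holomorphic_on_subset[OF change_holomorphic[OF c d]]) (auto simp: W_def overlap_def)
  have im: "change c d ` snd c ` W \<subseteq> overlap d e"
    using cc by (auto simp: W_def overlap_def change_chart[of X])
  have ov: "snd c p \<in> overlap c d" "snd d p \<in> overlap d e" "snd c p \<in> overlap c e"
    using p by (auto simp: overlap_def)
  have fp: "change c d (snd c p) = snd d p" using cc p by (simp add: change_chart[of X])
  have g: "change c e y = change d e (change c d y)" if "y \<in> snd c ` W" for y
    using that cc dd by (auto simp: W_def change_chart[of X])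
  show "schwarzian (change c e) (snd c p) =
      schwarzian (change d e) (snd d p) * (deriv (change c d) (snd c p))\<^sup>2
      + schwarzian (change c d) (snd c p)"
    using schwarzian_compose[OF op pW open_overlap[OF dd ee] f im change_holomorphic[OF d e] g]
      deriv_change_nonzero[OF c d ov(1)] deriv_change_nonzero[OF d e ov(2)]
    unfolding fp by blast
  have de: "((\<lambda>y. change d e (change c d y)) has_field_derivative
      deriv (change d e) (snd d p) * deriv (change c d) (snd c p)) (at (snd c p))"
    by (rule DERIV_chain2)
       (use holomorphic_derivI[OF change_holomorphic[OF d e] open_overlap[OF dd ee] ov(2)]
          holomorphic_derivI[OF change_holomorphic[OF c d] open_overlap[OF cc dd] ov(1)]
        in \<open>simp_all add: fp\<close>)
  have ce: "(change c e has_field_derivative deriv (change c e) (snd c p)) (at (snd c p))"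
    by (rule holomorphic_derivI[OF change_holomorphic[OF c e] open_overlap[OF cc ee] ov(3)])
  show "deriv (change c e) (snd c p) =
      deriv (change d e) (snd d p) * deriv (change c d) (snd c p)"
    by (rule deriv_unique_on_open[OF op pW g ce de])
qed

end

locale projectively_connected = riemann_surface_charts X \<A>
  for X :: "'p topology" and \<A> :: "'p coordinate set" +
  fixes \<V> :: "'p coordinate set" and R :: "'p coordinate \<Rightarrow> complex \<Rightarrow> complex"
  assumes connection: "projective_connection X \<A> \<V> R"
begin

lemma pc_hol_coord: "c \<in> \<V> \<Longrightarrow> hol_coord c"
  using connection unfolding projective_connection_def by blast

lemma pc_covers:
  assumes "p \<in> topspace X" obtains c where "c \<in> \<V>" "p \<in> fst c"
  using connection assms unfolding projective_connection_def by blast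

text \<open>The local representative is defined by a unique description. The value computed from one member
  of the covering satisfies the condition for every other member by the chain rules for the
  derivative and the Schwarzian derivative.\<close>

lemma pc_rep_eq:
  assumes c: "hol_coord c" and d: "d \<in> \<V>" and p: "p \<in> fst c" "p \<in> fst d"
  shows "pc_rep \<V> R c (snd c p) =
    R d (snd d p) * (deriv (change c d) (snd c p))\<^sup>2 - schwarzian (change c d) (snd c p)"
  unfolding pc_rep_def
proof (rule the_equality)
  note cc = hol_coord_chart[OF c] and dd = pc_hol_coord[OF d]
  show "\<forall>e\<in>\<V>. snd c p \<in> overlap c e \<longrightarrow>
      R e (change c e (snd c p)) * (deriv (change c e) (snd c p))\<^sup>2 =
      R d (snd d p) * (deriv (change c d) (snd c p))\<^sup>2 - schwarzian (change c d) (snd c p) +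
      schwarzian (change c e) (snd c p)"
  proof (intro ballI impI)
    fix e assume e: "e \<in> \<V>" and "snd c p \<in> overlap c e"
    then have pe: "p \<in> fst e"
      using chart_inj[OF cc] p by (auto simp: overlap_def inj_on_def)
    note eh = pc_hol_coord[OF e]
    have "snd d p \<in> overlap d e" using p pe by (auto simp: overlap_def)
    then have "R e (change d e (snd d p)) * (deriv (change d e) (snd d p))\<^sup>2 =
        R d (snd d p) + schwarzian (change d e) (snd d p)"
      using connection d e unfolding projective_connection_def by blast
    then show "R e (change c e (snd c p)) * (deriv (change c e) (snd c p))\<^sup>2 =
      R d (snd d p) * (deriv (change c d) (snd c p))\<^sup>2 - schwarzian (change c d) (snd c p) +
      schwarzian (change c e) (snd c p)"
      using change_chain[OF c dd eh p pe] p hol_coord_chart[OF c] hol_coord_chart[OF dd]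
      by (simp add: change_chart[of X] power_mult_distrib flip: mult.assoc)
         (simp add: algebra_simps)
  qed
  fix r
  assume "\<forall>d\<in>\<V>. snd c p \<in> overlap c d \<longrightarrow>
      R d (change c d (snd c p)) * (deriv (change c d) (snd c p))\<^sup>2 =
      r + schwarzian (change c d) (snd c p)"
  moreover have "snd c p \<in> overlap c d" using p by (auto simp: overlap_def)
  ultimately show "r = R d (snd d p) * (deriv (change c d) (snd c p))\<^sup>2 -
      schwarzian (change c d) (snd c p)"
    using d p cc by (simp add: change_chart[of X])
qed

lemma pc_rep_change:
  assumes c: "hol_coord c" and d: "hol_coord d" and p: "p \<in> fst c" "p \<in> fst d"
  shows "pc_rep \<V> R d (snd d p) * (deriv (change c d) (snd c p))\<^sup>2 =
    pc_rep \<V> R c (snd c p) + schwarzian (change c d) (snd c p)"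
proof -
  have "p \<in> topspace X" using p chart_subset hol_coord_chart c by blast
  then obtain e where e: "e \<in> \<V>" "p \<in> fst e" by (rule pc_covers)
  show ?thesis
    using change_chain[OF c d pc_hol_coord[OF e(1)] p e(2)]
    unfolding pc_rep_eq[OF c e(1) p(1) e(2)] pc_rep_eq[OF d e(1) p(2) e(2)]
    by (simp add: power_mult_distrib algebra_simps)
qed

lemma pc_rep_holomorphic:
  assumes c: "hol_coord c"
  shows "pc_rep \<V> R c holomorphic_on (snd c ` fst c)"
proof (rule holomorphic_on_locally)
  fix x assume "x \<in> snd c ` fst c"
  then obtain p where p: "p \<in> fst c" "x = snd c p" by blast
  then have "p \<in> topspace X" using chart_subset hol_coord_chart c by blast
  then obtain d where d: "d \<in> \<V>" "p \<in> fst d" by (rule pc_covers)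
  note dh = pc_hol_coord[OF d(1)]
  note op = open_overlap[OF hol_coord_chart[OF c] hol_coord_chart[OF dh]]
  note f = change_holomorphic[OF c dh]
  note f1 = holomorphic_deriv[OF f op]
  note f2 = holomorphic_deriv[OF f1 op]
  note f3 = holomorphic_deriv[OF f2 op]
  have "R d holomorphic_on (snd d ` fst d)"
    using connection d(1) unfolding projective_connection_def by blast
  moreover have "change c d ` overlap c d \<subseteq> snd d ` fst d"
    using hol_coord_chart[OF c] by (auto simp: overlap_def change_chart[of X])
  ultimately have "(\<lambda>y. R d (change c d y)) holomorphic_on overlap c d"
    using holomorphic_on_compose_gen[OF f] by (simp add: o_def)
  then have "(\<lambda>y. R d (change c d y) * (deriv (change c d) y)\<^sup>2 - schwarzian (change c d) y)
      holomorphic_on overlap c d"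
    unfolding schwarzian_def higher_deriv_numeral
    by (intro holomorphic_intros f1 f2 f3 deriv_change_nonzero[OF c dh])
  moreover have "\<forall>y\<in>overlap c d. pc_rep \<V> R c y =
      R d (change c d y) * (deriv (change c d) y)\<^sup>2 - schwarzian (change c d) y"
    using pc_rep_eq[OF c d(1)] hol_coord_chart[OF c]
    by (auto simp: overlap_def change_chart[of X])
  moreover have "x \<in> overlap c d" using p d by (auto simp: overlap_def)
  ultimately show "\<exists>T g. open T \<and> x \<in> T \<and> g holomorphic_on T \<and> (\<forall>y\<in>T. pc_rep \<V> R c y = g y)"
    using op by blast
qed

end

section \<open>Sections of the powers of a theta characteristic\<close>

locale theta_surface = riemann_surface_charts X \<A>
  for X :: "'p topology" and \<A> :: "'p coordinate set" +
  fixes A :: "'p set" and L :: "('i, 'p) hol_bundle"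
  assumes finite_A: "finite A" and theta: "theta_characteristic X \<A> L"
begin

abbreviation "vfields \<equiv> F_forms A L (-2)"
abbreviation "spinors \<equiv> F_forms A L (-1)"
abbreviation "differentials \<equiv> meromorphic_sections A (canonical_bundle L)"

definition reg :: "'i \<Rightarrow> complex set" where
  "reg i = z_of L i ` (patch L i - A)"

definition ovl :: "'i \<Rightarrow> 'i \<Rightarrow> complex set" where
  "ovl i j = z_of L i ` (patch L i \<inter> patch L j - A)"

abbreviation chg :: "'i \<Rightarrow> 'i \<Rightarrow> complex \<Rightarrow> complex" where
  "chg i j \<equiv> change (coord L i) (coord L j)"

text \<open>The frames of \<open>L\<close> are \<open>(dz)\<^bsup>1/2\<^esup>\<close>, so the inverse of the transition function is a square root of
  the derivative of the coordinate change, namely the one that \<open>L\<close> selects.\<close>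

definition half :: "'i \<Rightarrow> 'i \<Rightarrow> complex \<Rightarrow> complex" where
  "half i j y = inverse (transition L j i (point_at (coord L i) y))"

lemma
  shows L_bundle: "line_bundle X \<A> L"
  and square: "same_bundle (tensor_power L 2) (canonical_bundle L)"
  using theta unfolding theta_characteristic_def by blast+

lemma frame_hol_coord: "i \<in> index L \<Longrightarrow> hol_coord (coord L i)"
  using L_bundle unfolding line_bundle_def by blast

lemma frame_chart: "i \<in> index L \<Longrightarrow> is_chart X (coord L i)"
  using frame_hol_coord hol_coord_chart by blast

lemma frames_cover:
  assumes "p \<in> topspace X" obtains i where "i \<in> index L" "p \<in> patch L i"
  using L_bundle assms unfolding line_bundle_def by blast

lemma openin_minus_A: "openin X U \<Longrightarrow> openin X (U - A)"
proof -
  assume U: "openin X U"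
  have "closedin X (topspace X \<inter> A)"
    using surface finite_A unfolding riemann_surface_def
    by (intro closedin_Hausdorff_finite) auto
  moreover have "U - A = U - (topspace X \<inter> A)" using openin_subset[OF U] by blast
  ultimately show ?thesis using U by (metis openin_diff)
qed

lemma open_reg: "i \<in> index L \<Longrightarrow> open (reg i)"
  unfolding reg_def
  by (intro open_chart_image frame_hol_coord openin_minus_A open_patch) auto

lemma open_ovl: "i \<in> index L \<Longrightarrow> j \<in> index L \<Longrightarrow> open (ovl i j)"
  unfolding ovl_def
  by (intro open_chart_image frame_hol_coord openin_minus_A openin_Int open_patch) auto

lemma ovl_subset_reg: "ovl i j \<subseteq> reg i"
  unfolding ovl_def reg_def by blast

lemma ovl_subset_overlap: "ovl i j \<subseteq> overlap (coord L i) (coord L j)"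
  unfolding ovl_def overlap_def by blast

lemma half_at [simp]: "i \<in> index L \<Longrightarrow> p \<in> patch L i \<Longrightarrow>
    half i j (z_of L i p) = inverse (transition L j i p)"
  unfolding half_def using frame_chart by (simp add: point_at_chart[of X])

lemma transition_nonzero:
  "i \<in> index L \<Longrightarrow> j \<in> index L \<Longrightarrow> p \<in> patch L i \<inter> patch L j \<Longrightarrow> transition L j i p \<noteq> 0"
  using L_bundle unfolding line_bundle_def by blast

lemma transition_square:
  assumes "i \<in> index L" "j \<in> index L" "p \<in> patch L i \<inter> patch L j"
  shows "(transition L j i p)\<^sup>2 = inverse (deriv (chg i j) (z_of L i p))"
  using square assms unfolding same_bundle_def tensor_power_def canonical_bundle_def by auto

text \<open>This is where \<open>L\<^bsup>\<otimes>2\<^esup> = \<K>\<close> enters: every overlap of two frames is an instance of the local model.\<close>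

lemma half_jacobian_change:
  assumes i: "i \<in> index L" and j: "j \<in> index L"
  shows "half_jacobian (ovl i j) (reg j) (chg i j) (half i j)"
proof
  show "open (ovl i j)" "open (reg j)" using open_ovl open_reg i j by auto
  show "chg i j holomorphic_on ovl i j"
    using change_holomorphic[OF frame_hol_coord[OF i] frame_hol_coord[OF j]] ovl_subset_overlap
    by (rule holomorphic_on_subset)
  show "chg i j ` ovl i j \<subseteq> reg j"
    using frame_chart[OF i] by (auto simp: ovl_def reg_def change_chart[of X])
  have "(\<lambda>x. transition L j i (point_at (coord L i) x)) holomorphic_on ovl i j"
    using L_bundle i j ovl_subset_overlap unfolding line_bundle_def
    by (blast intro: holomorphic_on_subset)
  then show "half i j holomorphic_on ovl i j"
    unfolding half_def
    using transition_nonzero[OF i j] frame_chart[OF i]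
    by (intro holomorphic_on_inverse) (auto simp: ovl_def point_at_chart[of X])
  fix y assume "y \<in> ovl i j"
  then obtain p where p: "p \<in> patch L i \<inter> patch L j" "y = z_of L i p"
    unfolding ovl_def by blast
  show "half i j y \<noteq> 0"
    using transition_nonzero[OF i j p(1)] p i by simp
  show "deriv (chg i j) y = (half i j y)\<^sup>2"
    using transition_square[OF i j p(1)] p i by (simp add: power_inverse)
qed

text \<open>The conditions on a section that do not involve the transition functions. They are the
  same for all powers of the bundle.\<close>

definition regular :: "'i lsection \<Rightarrow> bool" where
  "regular s \<longleftrightarrow>
     (\<forall>i\<in>index L. s i meromorphic_on (z_of L i ` patch L i) \<and> s i holomorphic_on reg i) \<and>
     (\<forall>i x. \<not> (i \<in> index L \<and> x \<in> reg i) \<longrightarrow> s i x = 0)"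

lemma
  shows regular_mero: "regular s \<Longrightarrow> i \<in> index L \<Longrightarrow> s i meromorphic_on (z_of L i ` patch L i)"
  and regular_holo: "regular s \<Longrightarrow> i \<in> index L \<Longrightarrow> s i holomorphic_on reg i"
  and regular_off: "regular s \<Longrightarrow> \<not> (i \<in> index L \<and> x \<in> reg i) \<Longrightarrow> s i x = 0"
  unfolding regular_def by blast+

lemma ball_ovl:
  "(\<forall>y\<in>ovl i j. P y) \<longleftrightarrow> (\<forall>p\<in>patch L i \<inter> patch L j - A. P (z_of L i p))"
  unfolding ovl_def by blast

text \<open>The transition law read in the coordinate \<open>z\<^sub>i\<close>, as an identity of functions on an open set that
  can be differentiated.\<close>

lemma F_forms_iff:
  "s \<in> F_forms A L k \<longleftrightarrow> regular s \<and>
     (\<forall>i\<in>index L. \<forall>j\<in>index L. \<forall>y\<in>ovl i j. s j (chg i j y) = half i j y powi (- k) * s i y)"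
proof -
  have "(s j (z_of L j p) = transition (tensor_power L k) j i p * s i (z_of L i p)) \<longleftrightarrow>
        (s j (chg i j (z_of L i p)) = half i j (z_of L i p) powi (- k) * s i (z_of L i p))"
    if "i \<in> index L" "p \<in> patch L i \<inter> patch L j - A" for i j p
    using that frame_chart[of i]
    by (simp add: tensor_power_def change_chart[of X] power_int_inverse power_int_minus)
  then have "(\<forall>i\<in>index L. \<forall>j\<in>index L. \<forall>p\<in>patch L i \<inter> patch L j - A.
      s j (z_of L j p) = transition (tensor_power L k) j i p * s i (z_of L i p)) \<longleftrightarrow>
    (\<forall>i\<in>index L. \<forall>j\<in>index L. \<forall>y\<in>ovl i j. s j (chg i j y) = half i j y powi (- k) * s i y)"
    unfolding ball_ovl by (intro ball_cong refl) blast
  moreover have "index (tensor_power L k) = index L" "coord (tensor_power L k) = coord L"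
    by (simp_all add: tensor_power_def)
  ultimately show ?thesis
    unfolding F_forms_def meromorphic_sections_def regular_def reg_def mem_Collect_eq de_Morgan_conj
    by (simp add: ball_conj_distrib conj_assoc)
qed

lemma vfields_iff:
  "s \<in> vfields \<longleftrightarrow> regular s \<and>
     (\<forall>i\<in>index L. \<forall>j\<in>index L. \<forall>y\<in>ovl i j. s j (chg i j y) = (half i j y)\<^sup>2 * s i y)"
  unfolding F_forms_iff by simp

lemma spinors_iff:
  "s \<in> spinors \<longleftrightarrow> regular s \<and>
     (\<forall>i\<in>index L. \<forall>j\<in>index L. \<forall>y\<in>ovl i j. s j (chg i j y) = half i j y * s i y)"
  unfolding F_forms_iff by simp

lemma differentials_eq: "differentials = F_forms A L 2"
  using square
  unfolding same_bundle_def F_forms_def meromorphic_sections_def canonical_bundle_def tensor_power_def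
  by (intro Collect_cong) auto

lemma differentials_iff:
  "s \<in> differentials \<longleftrightarrow> regular s \<and>
     (\<forall>i\<in>index L. \<forall>j\<in>index L. \<forall>y\<in>ovl i j. s j (chg i j y) * (half i j y)\<^sup>2 = s i y)"
proof -
  have "s j (chg i j y) * (half i j y)\<^sup>2 = s i y \<longleftrightarrow>
      s j (chg i j y) = half i j y powi (- 2) * s i y"
    if "i \<in> index L" "j \<in> index L" "y \<in> ovl i j" for i j y
    using half_jacobian.h_nz[OF half_jacobian_change[OF that(1,2)] that(3)]
    by (simp add: power_int_minus field_simps)
  then show ?thesis
    unfolding differentials_eq F_forms_iff by (metis (no_types, lifting))
qed

lemma F_forms_regular: "s \<in> F_forms A L k \<Longrightarrow> regular s"
  unfolding F_forms_iff by blast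

lemma regular_add: "regular s \<Longrightarrow> regular t \<Longrightarrow> regular (s + t)"
  unfolding regular_def plus_fun_def by (auto intro!: meromorphic_intros holomorphic_intros)

lemma regular_scale: "regular s \<Longrightarrow> regular (sec_scale c s)"
  unfolding regular_def sec_scale_def by (auto intro!: meromorphic_intros holomorphic_intros)

lemma regular_zero: "regular 0"
  unfolding regular_def zero_fun_def by auto

lemma F_forms_add: "s \<in> F_forms A L k \<Longrightarrow> t \<in> F_forms A L k \<Longrightarrow> s + t \<in> F_forms A L k"
  unfolding F_forms_iff by (simp add: regular_add distrib_left)

lemma F_forms_scale: "s \<in> F_forms A L k \<Longrightarrow> sec_scale c s \<in> F_forms A L k"
  unfolding F_forms_iff by (simp add: regular_scale) (simp add: sec_scale_def)

lemma F_forms_zero: "0 \<in> F_forms A L k"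
  unfolding F_forms_iff by (simp add: regular_zero)

lemma sec_scale_minus_one: "sec_scale (-1) s = - s"
  by (simp add: sec_scale_def fun_eq_iff)

lemma F_forms_minus: "s \<in> F_forms A L k \<Longrightarrow> - s \<in> F_forms A L k"
  using F_forms_scale[of s k "-1"] unfolding sec_scale_minus_one .

lemma regular_jet:
  assumes "regular s" "i \<in> index L" "x \<in> reg i"
  shows "(s i has_field_derivative deriv (s i) x) (at x)"
    "(deriv (s i) has_field_derivative deriv (deriv (s i)) x) (at x)"
    "(deriv (deriv (s i)) has_field_derivative deriv (deriv (deriv (s i))) x) (at x)"
    "(deriv (deriv (deriv (s i))) has_field_derivative deriv (deriv (deriv (deriv (s i)))) x) (at x)"
  using holomorphic_jet[OF regular_holo[OF assms(1,2)] open_reg[OF assms(2)] assms(3)] .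

lemma regular_bracket:
  assumes "regular e" "regular f"
  shows "regular (vf_bracket e f)"
  unfolding regular_def vf_bracket_def using assms
  by (auto intro!: meromorphic_intros holomorphic_intros holomorphic_deriv
      simp: regular_mero regular_holo regular_off open_reg)

lemma regular_action:
  assumes "regular e" "regular f"
  shows "regular (vf_action e f)"
  unfolding regular_def vf_action_def using assms
  by (auto intro!: meromorphic_intros holomorphic_intros holomorphic_deriv
      simp: regular_mero regular_holo regular_off open_reg)

lemma regular_mult:
  assumes "regular e" "regular f"
  shows "regular (sec_mult e f)"
  unfolding regular_def sec_mult_def using assms
  by (auto intro!: meromorphic_intros holomorphic_intros
      simp: regular_mero regular_holo regular_off)

lemma vfield_change:
  assumes e: "e \<in> vfields" and ij: "i \<in> index L" "j \<in> index L" and y: "y \<in> ovl i j"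
  defines "a \<equiv> half_jacobian.dlog (half i j)"
  shows "e j (chg i j y) = (half i j y)\<^sup>2 * e i y"
    "deriv (e j) (chg i j y) = deriv (e i) y + 2 * a y * e i y"
    "deriv (deriv (e j)) (chg i j y) * (half i j y)\<^sup>2 =
       deriv (deriv (e i)) y + 2 * a y * deriv (e i) y + 2 * deriv a y * e i y"
    "deriv (deriv (deriv (e j))) (chg i j y) * (half i j y) ^ 4 =
       deriv (deriv (deriv (e i))) y + 4 * (deriv a y - (a y)\<^sup>2) * deriv (e i) y +
       (2 * deriv (deriv a) y - 4 * a y * deriv a y) * e i y"
proof -
  interpret J: half_jacobian "ovl i j" "reg j" "chg i j" "half i j"
    by (rule half_jacobian_change[OF ij])
  have e': "regular e" "\<And>y. y \<in> ovl i j \<Longrightarrow> e j (chg i j y) = (half i j y)\<^sup>2 * e i y"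
    using e ij unfolding vfields_iff by blast+
  note jets = J.vector_field_jet[OF regular_holo[OF e'(1) ij(2)]
      holomorphic_on_subset[OF regular_holo[OF e'(1) ij(1)] ovl_subset_reg] e'(2) y]
  show "e j (chg i j y) = (half i j y)\<^sup>2 * e i y"
    "deriv (e j) (chg i j y) = deriv (e i) y + 2 * a y * e i y"
    "deriv (deriv (e j)) (chg i j y) * (half i j y)\<^sup>2 =
       deriv (deriv (e i)) y + 2 * a y * deriv (e i) y + 2 * deriv a y * e i y"
    "deriv (deriv (deriv (e j))) (chg i j y) * (half i j y) ^ 4 =
       deriv (deriv (deriv (e i))) y + 4 * (deriv a y - (a y)\<^sup>2) * deriv (e i) y +
       (2 * deriv (deriv a) y - 4 * a y * deriv a y) * e i y"
    using e'(2)[OF y] jets unfolding a_def by blast+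
qed

lemma spinor_change:
  assumes p: "p \<in> spinors" and ij: "i \<in> index L" "j \<in> index L" and y: "y \<in> ovl i j"
  defines "a \<equiv> half_jacobian.dlog (half i j)"
  shows "p j (chg i j y) = half i j y * p i y"
    "deriv (p j) (chg i j y) * half i j y = deriv (p i) y + a y * p i y"
    "deriv (deriv (p j)) (chg i j y) * (half i j y) ^ 3 =
       deriv (deriv (p i)) y + (deriv a y - (a y)\<^sup>2) * p i y"
proof -
  interpret J: half_jacobian "ovl i j" "reg j" "chg i j" "half i j"
    by (rule half_jacobian_change[OF ij])
  have p': "regular p" "\<And>y. y \<in> ovl i j \<Longrightarrow> p j (chg i j y) = half i j y * p i y"
    using p ij unfolding spinors_iff by blast+
  note jets = J.spinor_jet[OF regular_holo[OF p'(1) ij(2)]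
      holomorphic_on_subset[OF regular_holo[OF p'(1) ij(1)] ovl_subset_reg] p'(2) y]
  show "p j (chg i j y) = half i j y * p i y"
    "deriv (p j) (chg i j y) * half i j y = deriv (p i) y + a y * p i y"
    "deriv (deriv (p j)) (chg i j y) * (half i j y) ^ 3 =
       deriv (deriv (p i)) y + (deriv a y - (a y)\<^sup>2) * p i y"
    using p'(2)[OF y] jets unfolding a_def by blast+
qed

section \<open>The Lie superalgebra\<close>

lemma bracket_closed:
  assumes e: "e \<in> vfields" and f: "f \<in> vfields"
  shows "vf_bracket e f \<in> vfields"
  unfolding vfields_iff
proof (intro conjI ballI)
  show "regular (vf_bracket e f)" by (intro regular_bracket F_forms_regular[OF e] F_forms_regular[OF f])
  fix i j y assume ij: "i \<in> index L" "j \<in> index L" "y \<in> ovl i j"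
  show "vf_bracket e f j (chg i j y) = (half i j y)\<^sup>2 * vf_bracket e f i y"
    unfolding vf_bracket_def vfield_change(1,2)[OF e ij] vfield_change(1,2)[OF f ij]
    by (simp add: algebra_simps)
qed

lemma action_closed:
  assumes e: "e \<in> vfields" and p: "p \<in> spinors"
  shows "vf_action e p \<in> spinors"
  unfolding spinors_iff
proof (intro conjI ballI)
  show "regular (vf_action e p)" by (intro regular_action F_forms_regular[OF e] F_forms_regular[OF p])
  fix i j y assume ij: "i \<in> index L" "j \<in> index L" "y \<in> ovl i j"
  have "vf_action e p j (chg i j y) =
      half i j y * e i y * (deriv (p j) (chg i j y) * half i j y)
      - 1/2 * (half i j y * p i y) * deriv (e j) (chg i j y)"
    unfolding vf_action_def vfield_change(1)[OF e ij] spinor_change(1)[OF p ij]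
    by (simp add: power2_eq_square)
  also have "\<dots> = half i j y * vf_action e p i y"
    unfolding vf_action_def spinor_change(2)[OF p ij] vfield_change(2)[OF e ij]
    by (simp add: algebra_simps)
  finally show "vf_action e p j (chg i j y) = half i j y * vf_action e p i y" .
qed

lemma mult_closed:
  assumes p: "p \<in> spinors" and q: "q \<in> spinors"
  shows "sec_mult p q \<in> vfields"
  unfolding vfields_iff
proof (intro conjI ballI)
  show "regular (sec_mult p q)" by (intro regular_mult F_forms_regular[OF p] F_forms_regular[OF q])
qed (simp add: sec_mult_def spinor_change(1)[OF p] spinor_change(1)[OF q] power2_eq_square)

lemma deriv_add_sec:
  assumes "regular s" "regular t" "i \<in> index L" "x \<in> reg i"
  shows "deriv ((s + t) i) x = deriv (s i) x + deriv (t i) x" (is ?A)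
    "deriv (deriv ((s + t) i)) x = deriv (deriv (s i)) x + deriv (deriv (t i)) x" (is ?B)
    "deriv (deriv (deriv ((s + t) i))) x = deriv (deriv (deriv (s i))) x + deriv (deriv (deriv (t i))) x" (is ?C)
proof -
  note st = regular_jet[OF regular_add[OF assms(1,2)] assms(3)]
  note O = open_reg[OF assms(3)]
  have 0: "(s + t) i y = s i y + t i y" for y by simp
  have 1: "deriv ((s + t) i) y = deriv (s i) y + deriv (t i) y" if y: "y \<in> reg i" for y
    by (rule deriv_unique_on_open[OF O y 0 st(1)[OF y]])
       (auto intro!: DERIV_add regular_jet assms y)
  have 2: "deriv (deriv ((s + t) i)) y = deriv (deriv (s i)) y + deriv (deriv (t i)) y"
    if y: "y \<in> reg i" for y
    by (rule deriv_unique_on_open[OF O y 1 st(2)[OF y]])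
       (auto intro!: DERIV_add regular_jet assms y)
  have 3: "deriv (deriv (deriv ((s + t) i))) y =
      deriv (deriv (deriv (s i))) y + deriv (deriv (deriv (t i))) y"
    if y: "y \<in> reg i" for y
    by (rule deriv_unique_on_open[OF O y 2 st(3)[OF y]])
       (auto intro!: DERIV_add regular_jet assms y)
  show ?A ?B ?C using 1 2 3 assms(4) by blast+
qed

lemma deriv_scale_sec:
  assumes "regular s" "i \<in> index L" "x \<in> reg i"
  shows "deriv (sec_scale c s i) x = c * deriv (s i) x" (is ?A)
    "deriv (deriv (sec_scale c s i)) x = c * deriv (deriv (s i)) x" (is ?B)
    "deriv (deriv (deriv (sec_scale c s i))) x = c * deriv (deriv (deriv (s i))) x" (is ?C)
proof -
  note st = regular_scale[OF assms(1), of c]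
  note O = open_reg[OF assms(2)]
  have 0: "sec_scale c s i y = c * s i y" for y by (simp add: sec_scale_def)
  have 1: "deriv (sec_scale c s i) y = c * deriv (s i) y" if y: "y \<in> reg i" for y
    by (rule deriv_unique_on_open[OF O y 0 regular_jet(1)[OF st assms(2) y]])
       (auto intro!: DERIV_cmult regular_jet assms y)
  have 2: "deriv (deriv (sec_scale c s i)) y = c * deriv (deriv (s i)) y"
    if y: "y \<in> reg i" for y
    by (rule deriv_unique_on_open[OF O y 1 regular_jet(2)[OF st assms(2) y]])
       (auto intro!: DERIV_cmult regular_jet assms y)
  have 3: "deriv (deriv (deriv (sec_scale c s i))) y = c * deriv (deriv (deriv (s i))) y"
    if y: "y \<in> reg i" for y
    by (rule deriv_unique_on_open[OF O y 2 regular_jet(3)[OF st assms(2) y]])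
       (auto intro!: DERIV_cmult regular_jet assms y)
  show ?A ?B ?C using 1 2 3 assms(3) by blast+
qed

lemma deriv_bracket:
  assumes "regular e" "regular f" "i \<in> index L" "x \<in> reg i"
  shows "deriv (vf_bracket e f i) x = e i x * deriv (deriv (f i)) x - f i x * deriv (deriv (e i)) x" (is ?A)
    "deriv (deriv (vf_bracket e f i)) x =
       e i x * deriv (deriv (deriv (f i))) x + deriv (e i) x * deriv (deriv (f i)) x
       - f i x * deriv (deriv (deriv (e i))) x - deriv (f i) x * deriv (deriv (e i)) x" (is ?B)
    "deriv (deriv (deriv (vf_bracket e f i))) x =
       e i x * deriv (deriv (deriv (deriv (f i)))) x + 2 * deriv (e i) x * deriv (deriv (deriv (f i))) x
       - f i x * deriv (deriv (deriv (deriv (e i)))) x - 2 * deriv (f i) x * deriv (deriv (deriv (e i))) x" (is ?C)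
proof -
  note r = regular_bracket[OF assms(1,2)]
  note O = open_reg[OF assms(3)]
  note jets = regular_jet[OF assms(1,3)] regular_jet[OF assms(2,3)]
  have 0: "vf_bracket e f i y = e i y * deriv (f i) y - f i y * deriv (e i) y" for y
    by (simp add: vf_bracket_def)
  have 1: "deriv (vf_bracket e f i) y =
      e i y * deriv (deriv (f i)) y - f i y * deriv (deriv (e i)) y" if y: "y \<in> reg i" for y
    by (rule deriv_unique_on_open[OF O y 0 regular_jet(1)[OF r assms(3) y]])
       (auto intro!: derivative_eq_intros jets[OF y] simp: algebra_simps)
  have 2: "deriv (deriv (vf_bracket e f i)) y =
       e i y * deriv (deriv (deriv (f i))) y + deriv (e i) y * deriv (deriv (f i)) y
       - f i y * deriv (deriv (deriv (e i))) y - deriv (f i) y * deriv (deriv (e i)) y"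
    if y: "y \<in> reg i" for y
    by (rule deriv_unique_on_open[OF O y 1 regular_jet(2)[OF r assms(3) y]])
       (auto intro!: derivative_eq_intros jets[OF y] simp: algebra_simps)
  have 3: "deriv (deriv (deriv (vf_bracket e f i))) y =
       e i y * deriv (deriv (deriv (deriv (f i)))) y + 2 * deriv (e i) y * deriv (deriv (deriv (f i))) y
       - f i y * deriv (deriv (deriv (deriv (e i)))) y - 2 * deriv (f i) y * deriv (deriv (deriv (e i))) y"
    if y: "y \<in> reg i" for y
    by (rule deriv_unique_on_open[OF O y 2 regular_jet(3)[OF r assms(3) y]])
       (auto intro!: derivative_eq_intros jets[OF y] simp: algebra_simps)
  show ?A ?B ?C using 1 2 3 assms(4) by blast+
qed

lemma deriv_action:
  assumes "regular e" "regular p" "i \<in> index L" "x \<in> reg i"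
  shows "deriv (vf_action e p i) x =
      e i x * deriv (deriv (p i)) x + 1/2 * deriv (e i) x * deriv (p i) x
      - 1/2 * p i x * deriv (deriv (e i)) x" (is ?A)
    "deriv (deriv (vf_action e p i)) x =
      e i x * deriv (deriv (deriv (p i))) x + 3/2 * deriv (e i) x * deriv (deriv (p i)) x
      - 1/2 * p i x * deriv (deriv (deriv (e i))) x" (is ?B)
proof -
  note r = regular_action[OF assms(1,2)]
  note O = open_reg[OF assms(3)]
  note jets = regular_jet[OF assms(1,3)] regular_jet[OF assms(2,3)]
  have 0: "vf_action e p i y = e i y * deriv (p i) y - 1/2 * p i y * deriv (e i) y" for y
    by (simp add: vf_action_def)
  have 1: "deriv (vf_action e p i) y =
      e i y * deriv (deriv (p i)) y + 1/2 * deriv (e i) y * deriv (p i) y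
      - 1/2 * p i y * deriv (deriv (e i)) y" if y: "y \<in> reg i" for y
    by (rule deriv_unique_on_open[OF O y 0 regular_jet(1)[OF r assms(3) y]])
       (auto intro!: derivative_eq_intros jets[OF y] simp: field_simps)
  have 2: "deriv (deriv (vf_action e p i)) y =
      e i y * deriv (deriv (deriv (p i))) y + 3/2 * deriv (e i) y * deriv (deriv (p i)) y
      - 1/2 * p i y * deriv (deriv (deriv (e i))) y" if y: "y \<in> reg i" for y
    by (rule deriv_unique_on_open[OF O y 1 regular_jet(2)[OF r assms(3) y]])
       (auto intro!: derivative_eq_intros jets[OF y] simp: field_simps)
  show ?A ?B using 1 2 assms(4) by blast+
qed

lemma deriv_mult_sec:
  assumes "regular p" "regular q" "i \<in> index L" "x \<in> reg i"
  shows "deriv (sec_mult p q i) x = deriv (p i) x * q i x + p i x * deriv (q i) x" (is ?A)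
    "deriv (deriv (sec_mult p q i)) x = deriv (deriv (p i)) x * q i x
      + 2 * deriv (p i) x * deriv (q i) x + p i x * deriv (deriv (q i)) x" (is ?B)
    "deriv (deriv (deriv (sec_mult p q i))) x = deriv (deriv (deriv (p i))) x * q i x
      + 3 * deriv (deriv (p i)) x * deriv (q i) x + 3 * deriv (p i) x * deriv (deriv (q i)) x
      + p i x * deriv (deriv (deriv (q i))) x" (is ?C)
proof -
  note r = regular_mult[OF assms(1,2)]
  note O = open_reg[OF assms(3)]
  note jets = regular_jet[OF assms(1,3)] regular_jet[OF assms(2,3)]
  have 0: "sec_mult p q i y = p i y * q i y" for y
    by (simp add: sec_mult_def)
  have 1: "deriv (sec_mult p q i) y = deriv (p i) y * q i y + p i y * deriv (q i) y"
    if y: "y \<in> reg i" for y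
    by (rule deriv_unique_on_open[OF O y 0 regular_jet(1)[OF r assms(3) y]])
       (auto intro!: derivative_eq_intros jets[OF y] simp: algebra_simps)
  have 2: "deriv (deriv (sec_mult p q i)) y = deriv (deriv (p i)) y * q i y
      + 2 * deriv (p i) y * deriv (q i) y + p i y * deriv (deriv (q i)) y"
    if y: "y \<in> reg i" for y
    by (rule deriv_unique_on_open[OF O y 1 regular_jet(2)[OF r assms(3) y]])
       (auto intro!: derivative_eq_intros jets[OF y] simp: algebra_simps)
  have 3: "deriv (deriv (deriv (sec_mult p q i))) y = deriv (deriv (deriv (p i))) y * q i y
      + 3 * deriv (deriv (p i)) y * deriv (q i) y + 3 * deriv (p i) y * deriv (deriv (q i)) y
      + p i y * deriv (deriv (deriv (q i))) y"
    if y: "y \<in> reg i" for y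
    by (rule deriv_unique_on_open[OF O y 2 regular_jet(3)[OF r assms(3) y]])
       (auto intro!: derivative_eq_intros jets[OF y] simp: algebra_simps)
  show ?A ?B ?C using 1 2 3 assms(4) by blast+
qed

text \<open>Algebraic identities between sections need to be checked at regular points only. At the points of
  \<open>A\<close>, where derivatives of the representing functions may have arbitrary values, and outside the
  patches both sides are 0 by the normalisation of sections.\<close>

lemma sec_eqI:
  assumes "regular s" "regular t" "\<And>i x. i \<in> index L \<Longrightarrow> x \<in> reg i \<Longrightarrow> s i x = t i x"
  shows "s = t"
proof (intro ext)
  fix i x show "s i x = t i x"
    using assms(3) regular_off[OF assms(1), of i x] regular_off[OF assms(2), of i x]
    by (cases "i \<in> index L \<and> x \<in> reg i") auto
qed

lemma regular_minus: "regular s \<Longrightarrow> regular (- s)"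
  using regular_scale[of s "-1"] unfolding sec_scale_minus_one .

lemma regular_diff: "regular s \<Longrightarrow> regular t \<Longrightarrow> regular (s - t)"
  using regular_add[OF _ regular_minus] by fastforce

lemmas regular_intros = regular_add regular_scale regular_zero regular_minus regular_diff
  regular_bracket regular_action regular_mult

lemma bracket_swap: "vf_bracket f e = - vf_bracket e f"
  by (simp add: vf_bracket_def fun_eq_iff)

lemma mult_swap: "sec_mult p q = sec_mult q p"
  by (simp add: sec_mult_def fun_eq_iff)


lemma sec_scale_apply [simp]: "sec_scale c s i x = c * s i x"
  by (simp add: sec_scale_def)

lemma sec_mult_apply [simp]: "sec_mult s t i x = s i x * t i x"
  by (simp add: sec_mult_def)

lemma vf_bracket_apply [simp]: "vf_bracket e f i x = e i x * deriv (f i) x - f i x * deriv (e i) x"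
  by (simp add: vf_bracket_def)

lemma vf_action_apply [simp]: "vf_action e p i x = e i x * deriv (p i) x - 1/2 * p i x * deriv (e i) x"
  by (simp add: vf_action_def)

text \<open>A fully applied form of pointwise addition. Rewriting with it instead of the general rule leaves
  \<open>deriv ((s + t) i)\<close> intact for the differentiation rules.\<close>

lemma plus_sec_apply: "((s :: 'i lsection) + t) i x = s i x + t i x"
  by simp

lemma bracket_linear:
  assumes "regular e" "regular f" "regular g"
  shows "vf_bracket (e + f) g = vf_bracket e g + vf_bracket f g"
    "vf_bracket g (e + f) = vf_bracket g e + vf_bracket g f"
  by (rule sec_eqI; (intro regular_intros assms)?;
      simp add: deriv_add_sec plus_sec_apply assms algebra_simps del: plus_fun_apply)+

lemma action_linear:
  assumes "regular e" "regular f" "regular g"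
  shows "vf_action (e + f) g = vf_action e g + vf_action f g"
    "vf_action g (e + f) = vf_action g e + vf_action g f"
  by (rule sec_eqI; (intro regular_intros assms)?;
      simp add: deriv_add_sec plus_sec_apply assms field_simps del: plus_fun_apply)+

lemma bracket_scale:
  assumes "regular e" "regular g"
  shows "vf_bracket (sec_scale c e) g = sec_scale c (vf_bracket e g)"
    "vf_bracket g (sec_scale c e) = sec_scale c (vf_bracket g e)"
    "vf_action (sec_scale c e) g = sec_scale c (vf_action e g)"
    "vf_action g (sec_scale c e) = sec_scale c (vf_action g e)"
  by (rule sec_eqI; (intro regular_intros assms)?;
      simp add: deriv_scale_sec assms field_simps)+

lemma bracket_minus:
  assumes "regular e" "regular g"
  shows "vf_bracket (- e) g = - vf_bracket e g" "vf_bracket g (- e) = - vf_bracket g e"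
    "vf_action (- e) g = - vf_action e g" "vf_action g (- e) = - vf_action g e"
    "sec_mult (- e) g = - sec_mult e g" "sec_mult g (- e) = - sec_mult g e"
  using bracket_scale[OF assms, of "-1"] unfolding sec_scale_minus_one
  by (simp_all add: fun_eq_iff)

lemma mult_linear:
  "sec_mult (e + f) g = sec_mult e g + sec_mult f g"
  "sec_mult g (e + f) = sec_mult g e + sec_mult g f"
  "sec_mult (sec_scale c e) g = sec_scale c (sec_mult e g)"
  "sec_mult g (sec_scale c e) = sec_scale c (sec_mult g e)"
  by (simp_all add: fun_eq_iff algebra_simps)

lemma scale_linear:
  "sec_scale c (s + t) = sec_scale c s + sec_scale c t"
  "sec_scale c (s - t) = sec_scale c s - sec_scale c t"
  "sec_scale (c + d) s = sec_scale c s + sec_scale d s"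
  "sec_scale c (sec_scale d s) = sec_scale (c * d) s"
  "sec_scale 1 s = s"
  "sec_scale c 0 = 0"
  "sec_scale 0 s = 0"
  by (simp_all add: fun_eq_iff algebra_simps)

lemma bracket_zero [simp]:
  "vf_bracket 0 e = 0" "vf_bracket e 0 = 0" "vf_action 0 e = 0" "vf_action e 0 = 0"
  "sec_mult 0 e = 0" "sec_mult e 0 = 0"
proof -
  have "deriv (0 :: complex \<Rightarrow> complex) x = 0" for x
    by (simp add: zero_fun_def)
  then show "vf_bracket 0 e = 0" "vf_bracket e 0 = 0" "vf_action 0 e = 0" "vf_action e 0 = 0"
    "sec_mult 0 e = 0" "sec_mult e 0 = 0"
    by (simp_all add: fun_eq_iff)
qed

text \<open>The four identities behind the super Jacobi identity, one for each number of odd arguments: the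
  Jacobi identity for vector fields, the representation property on spinors, the Leibniz rule for
  the product of spinors, and the identity for three spinors. At a regular point each is a polynomial
  identity between derivatives of the representing functions.\<close>

lemma bracket_jacobi:
  assumes "regular e" "regular f" "regular g"
  shows "vf_bracket e (vf_bracket f g) + vf_bracket f (vf_bracket g e) + vf_bracket g (vf_bracket e f) = 0"
  by (rule sec_eqI; (intro regular_intros assms)?;
      simp add: deriv_bracket assms algebra_simps)

lemma action_bracket:
  assumes "regular e" "regular f" "regular p"
  shows "vf_action (vf_bracket e f) p = vf_action e (vf_action f p) - vf_action f (vf_action e p)"
  by (rule sec_eqI; (intro regular_intros assms)?;
      simp add: deriv_bracket deriv_action assms field_simps)

lemma bracket_mult:
  assumes "regular e" "regular p" "regular q"
  shows "vf_bracket e (sec_mult p q) = sec_mult p (vf_action e q) + sec_mult q (vf_action e p)"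
  by (rule sec_eqI; (intro regular_intros assms)?;
      simp add: deriv_mult_sec assms field_simps)

lemma spinor_jacobi:
  assumes "regular p" "regular q" "regular r"
  shows "vf_action (sec_mult p q) r + vf_action (sec_mult q r) p + vf_action (sec_mult r p) q = 0"
  by (rule sec_eqI; (intro regular_intros assms)?;
      simp add: deriv_mult_sec assms field_simps)

abbreviation "KN \<equiv> KN_superalgebra A L"

lemma KN_simps:
  "scl KN c (e, p) = (sec_scale c e, sec_scale c p)"
  "brk KN (e, p) (f, q) = (vf_bracket e f + sec_mult p q, vf_action e q - vf_action f p)"
  "(e, p) \<in> part KN 0 \<longleftrightarrow> e \<in> vfields \<and> p = 0"
  "(e, p) \<in> part KN 1 \<longleftrightarrow> e = 0 \<and> p \<in> spinors"
  "(e, p) \<in> part KN (Suc 0) \<longleftrightarrow> e = 0 \<and> p \<in> spinors"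
  by (auto simp: KN_superalgebra_def)

lemma total_KN: "total KN = vfields \<times> spinors"
proof -
  have "(e, p) \<in> total KN" if "e \<in> vfields" "p \<in> spinors" for e p
  proof -
    have "(e, p) = (e, 0) + (0, p)" by simp
    moreover have "(e, 0) \<in> part KN 0" "(0, p) \<in> part KN 1" using that by (simp_all add: KN_simps)
    ultimately show ?thesis unfolding total_def by blast
  qed
  moreover have "x \<in> vfields \<times> spinors" if "x \<in> total KN" for x
    using that by (force simp: total_def KN_superalgebra_def)
  ultimately show ?thesis by auto
qed

lemma KN_superspace: "is_superspace KN"
proof -
  have v: "vector_space (scl KN)"
    unfolding vector_space_def by (simp add: split_paired_all KN_simps scale_linear)
  then have m: "module (scl KN)" by (simp add: module_iff_vector_space)
  have "part KN 0 \<inter> part KN 1 = {0}"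
    by (auto simp: KN_superalgebra_def zero_prod_def F_forms_zero)
  moreover have "module.subspace (scl KN) (part KN 0)" "module.subspace (scl KN) (part KN 1)"
    unfolding module.subspace_def[OF m]
    by (simp_all add: split_paired_all Ball_def KN_simps zero_prod_def scale_linear F_forms_zero
        F_forms_add F_forms_scale)
  ultimately show ?thesis
    using v unfolding is_superspace_def by blast
qed

lemma KN_bilinear: "bilinear_map_on (scl KN) (scl KN) (total KN) (brk KN)"
  unfolding bilinear_map_on_def total_KN
  by (auto simp: KN_simps bracket_linear action_linear bracket_scale mult_linear scale_linear F_forms_regular
      algebra_simps)

lemma KN_bracket:
  assumes "p \<in> {0, 1}" "q \<in> {0, 1}" "x \<in> part KN p" "y \<in> part KN q"
  shows "brk KN x y \<in> part KN ((p + q) mod 2)"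
    "brk KN x y = scl KN (- ((-1) ^ (p * q))) (brk KN y x)"
proof -
  obtain e s where x: "x = (e, s)" by fastforce
  obtain f t where y: "y = (f, t)" by fastforce
  show "brk KN x y \<in> part KN ((p + q) mod 2)"
    using assms unfolding x y
    by (auto simp: KN_simps bracket_closed action_closed mult_closed F_forms_minus)
  show "brk KN x y = scl KN (- ((-1) ^ (p * q))) (brk KN y x)"
    using assms unfolding x y
    by (auto simp: KN_simps scale_linear sec_scale_minus_one mult_swap[of t s] bracket_swap[of f e])
qed

text \<open>The signed sum is invariant under cyclic permutation of its arguments, so the eight parity cases
  reduce to the four identities above.\<close>

lemma KN_jacobi:
  assumes "p \<in> {0, 1}" "q \<in> {0, 1}" "r \<in> {0, 1}"
    "x \<in> part KN p" "y \<in> part KN q" "z \<in> part KN r"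
  shows "scl KN ((-1) ^ (p * r)) (brk KN x (brk KN y z)) +
        scl KN ((-1) ^ (q * p)) (brk KN y (brk KN z x)) +
        scl KN ((-1) ^ (r * q)) (brk KN z (brk KN x y)) = 0"
proof -
  obtain e s where x: "x = (e, s)" by fastforce
  obtain f t where y: "y = (f, t)" by fastforce
  obtain g u where z: "z = (g, u)" by fastforce
  have R: "regular e" "regular f" "regular g" "regular s" "regular t" "regular u"
    using assms unfolding x y z by (auto simp: KN_simps regular_zero F_forms_regular)
  have J: "vf_bracket e (vf_bracket f g) + vf_bracket f (vf_bracket g e)
      + vf_bracket g (vf_bracket e f) = 0"
    using bracket_jacobi R by blast
  have K: "vf_action (sec_mult t u) s + vf_action (sec_mult u s) t + vf_action (sec_mult s t) u = 0"
    using spinor_jacobi R by blast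
  note simps = KN_simps zero_prod_def scale_linear sec_scale_minus_one R regular_intros
    bracket_minus action_bracket bracket_mult
  consider "p = 0" "q = 0" "r = 0" | "p = 0" "q = 0" "r = 1" | "p = 0" "q = 1" "r = 0"
    | "p = 1" "q = 0" "r = 0" | "p = 0" "q = 1" "r = 1" | "p = 1" "q = 0" "r = 1"
    | "p = 1" "q = 1" "r = 0" | "p = 1" "q = 1" "r = 1"
    using assms(1-3) by blast
  then show ?thesis
  proof cases
    case 1 then show ?thesis using assms J unfolding x y z by (simp add: simps)
  next
    case 2 then show ?thesis using assms unfolding x y z by (simp add: simps)
  next
    case 3 then show ?thesis using assms unfolding x y z by (simp add: simps)
  next
    case 4 then show ?thesis using assms unfolding x y z by (simp add: simps)
  next
    case 5 then show ?thesis using assms unfolding x y z by (simp add: simps)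
  next
    case 6 then show ?thesis using assms unfolding x y z by (simp add: simps)
  next
    case 7 then show ?thesis using assms unfolding x y z by (simp add: simps)
  next
    case 8 then show ?thesis using assms K unfolding x y z by (simp add: simps)
  qed
qed

proposition KN_lie_superalgebra: "lie_superalgebra KN"
  unfolding lie_superalgebra_def
proof (intro conjI)
  show "is_superspace KN" by (rule KN_superspace)
  show "bilinear_map_on (scl KN) (scl KN) (total KN) (brk KN)" by (rule KN_bilinear)
qed (intro ballI conjI KN_bracket KN_jacobi; assumption)+

end

section \<open>The integrands and their primitives\<close>

locale theta_connection = theta_surface X \<A> A L + projectively_connected X \<A> \<V> R
  for X :: "'p topology" and \<A> :: "'p coordinate set" and A :: "'p set"
    and L :: "('i, 'p) hol_bundle"
    and \<V> :: "'p coordinate set" and R :: "'p coordinate \<Rightarrow> complex \<Rightarrow> complex"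
begin

abbreviation "even_form \<equiv> even_integrand L \<V> R"
abbreviation "odd_form \<equiv> odd_integrand L \<V> R"
abbreviation "pc i \<equiv> pc_rep \<V> R (coord L i)"

lemma even_form_apply:
  "even_form e f i x =
     1/2 * (deriv (deriv (deriv (e i))) x * f i x - e i x * deriv (deriv (deriv (f i))) x)
     - pc i x * (deriv (e i) x * f i x - e i x * deriv (f i) x)"
  by (simp add: even_integrand_def higher_deriv_numeral)

lemma odd_form_apply:
  "odd_form p q i x =
     deriv (deriv (p i)) x * q i x + p i x * deriv (deriv (q i)) x - pc i x * p i x * q i x"
  by (simp add: odd_integrand_def higher_deriv_numeral)

lemma pc_holo: "i \<in> index L \<Longrightarrow> pc i holomorphic_on (z_of L i ` patch L i)"
  using pc_rep_holomorphic frame_hol_coord by blast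

lemma pc_holo_reg: "i \<in> index L \<Longrightarrow> pc i holomorphic_on reg i"
  by (rule holomorphic_on_subset[OF pc_holo]) (auto simp: reg_def)

lemma pc_mero: "i \<in> index L \<Longrightarrow> pc i meromorphic_on (z_of L i ` patch L i)"
  by (intro analytic_on_imp_meromorphic_on)
     (simp add: analytic_on_open open_chart_image frame_hol_coord open_patch pc_holo)

text \<open>The transformation law of \<open>R\<close>, with \<open>f' = h\<^sup>2\<close> and the Schwarzian derivative expressed by \<open>h\<close>.\<close>

lemma pc_change:
  assumes ij: "i \<in> index L" "j \<in> index L" and y: "y \<in> ovl i j"
  defines "a \<equiv> half_jacobian.dlog (half i j)"
  shows "pc j (chg i j y) * (half i j y) ^ 4 = pc i y + 2 * deriv a y - 2 * (a y)\<^sup>2"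
proof -
  interpret J: half_jacobian "ovl i j" "reg j" "chg i j" "half i j"
    by (rule half_jacobian_change[OF ij])
  obtain p where p: "p \<in> patch L i" "p \<in> patch L j" "y = z_of L i p"
    using y unfolding ovl_def by blast
  have "pc j (z_of L j p) * (deriv (chg i j) (z_of L i p))\<^sup>2 =
      pc i (z_of L i p) + schwarzian (chg i j) (z_of L i p)"
    by (rule pc_rep_change[OF frame_hol_coord[OF ij(1)] frame_hol_coord[OF ij(2)] p(1,2)])
  moreover have "z_of L j p = chg i j y"
    using p frame_chart[OF ij(1)] by (simp add: change_chart[of X])
  ultimately show ?thesis
    using J.deriv_f[OF y] J.schwarzian_f[OF y] p(3) unfolding a_def by (simp add: algebra_simps)
qed

text \<open>In \<open>e'''f - e f'''\<close> the correction terms proportional to \<open>e f\<close> cancel by antisymmetry. Those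
  containing \<open>e' f - e f'\<close> carry the Schwarzian derivative and are absorbed by \<open>R\<close>. At the points of
  \<open>A\<close> every summand has an underived factor, hence the integrand is 0 there, as the normalisation of
  sections demands.\<close>

lemma even_form_differential:
  assumes e: "e \<in> vfields" and f: "f \<in> vfields"
  shows "even_form e f \<in> differentials"
  unfolding differentials_iff
proof (intro conjI ballI)
  note r = F_forms_regular[OF e] F_forms_regular[OF f]
  show "regular (even_form e f)"
    unfolding regular_def even_form_apply[abs_def]
    by (auto intro!: meromorphic_intros holomorphic_intros holomorphic_deriv
        simp: regular_mero regular_holo regular_off open_reg pc_mero pc_holo_reg r)
  fix i j y assume ij: "i \<in> index L" "j \<in> index L" "y \<in> ovl i j"
  let ?y = "chg i j y" and ?h = "half i j y"
  have "even_form e f j ?y * ?h\<^sup>2 =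
      1/2 * (deriv (deriv (deriv (e j))) ?y * ?h ^ 4 * f i y
        - e i y * (deriv (deriv (deriv (f j))) ?y * ?h ^ 4))
      - pc j ?y * ?h ^ 4 * (deriv (e j) ?y * f i y - e i y * deriv (f j) ?y)"
    unfolding even_form_apply vfield_change(1)[OF e ij] vfield_change(1)[OF f ij]
    by (simp add: field_simps power4_eq_xxxx power2_eq_square)
  also have "\<dots> = even_form e f i y"
    unfolding vfield_change(2,4)[OF e ij] vfield_change(2,4)[OF f ij] pc_change[OF ij] even_form_apply
    by (simp add: field_simps)
  finally show "even_form e f j ?y * ?h\<^sup>2 = even_form e f i y" .
qed

text \<open>Together the two second derivatives contribute the Schwarzian derivative times \<open>p q\<close>, which is
  what the transformation law of \<open>R\<close> compensates.\<close>

lemma odd_form_differential: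
  assumes p: "p \<in> spinors" and q: "q \<in> spinors"
  shows "odd_form p q \<in> differentials"
  unfolding differentials_iff
proof (intro conjI ballI)
  note r = F_forms_regular[OF p] F_forms_regular[OF q]
  show "regular (odd_form p q)"
    unfolding regular_def odd_form_apply[abs_def]
    by (auto intro!: meromorphic_intros holomorphic_intros holomorphic_deriv
        simp: regular_mero regular_holo regular_off open_reg pc_mero pc_holo_reg r)
  fix i j y assume ij: "i \<in> index L" "j \<in> index L" "y \<in> ovl i j"
  let ?y = "chg i j y" and ?h = "half i j y"
  have "odd_form p q j ?y * ?h\<^sup>2 =
      deriv (deriv (p j)) ?y * ?h ^ 3 * q i y + p i y * (deriv (deriv (q j)) ?y * ?h ^ 3)
      - pc j ?y * ?h ^ 4 * p i y * q i y"
    unfolding odd_form_apply spinor_change(1)[OF p ij] spinor_change(1)[OF q ij]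
    by (simp add: algebra_simps power4_eq_xxxx power2_eq_square power3_eq_cube)
  also have "\<dots> = odd_form p q i y"
    unfolding spinor_change(3)[OF p ij] spinor_change(3)[OF q ij] pc_change[OF ij] odd_form_apply
    by (simp add: algebra_simps)
  finally show "odd_form p q j ?y * ?h\<^sup>2 = odd_form p q i y" .
qed

lemma even_form_swap: "even_form f e = - even_form e f"
  by (simp add: fun_eq_iff even_form_apply field_simps)

lemma odd_form_swap: "odd_form q p = odd_form p q"
  by (simp add: fun_eq_iff odd_form_apply algebra_simps)

lemma differentials_regular: "w \<in> differentials \<Longrightarrow> regular w"
  unfolding differentials_iff by blast

lemma differentials_add: "v \<in> differentials \<Longrightarrow> w \<in> differentials \<Longrightarrow> v + w \<in> differentials"
  and differentials_scale: "v \<in> differentials \<Longrightarrow> sec_scale c v \<in> differentials"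
  unfolding differentials_eq by (rule F_forms_add F_forms_scale; assumption)+

lemma even_form_linear:
  assumes "e \<in> vfields" "f \<in> vfields" "g \<in> vfields"
  shows "even_form (e + f) g = even_form e g + even_form f g"
    "even_form (sec_scale c e) g = sec_scale c (even_form e g)"
proof -
  note r = F_forms_regular[OF assms(1)] F_forms_regular[OF assms(2)] F_forms_regular[OF assms(3)]
  note d = differentials_regular[OF even_form_differential]
  show "even_form (e + f) g = even_form e g + even_form f g"
    by (rule sec_eqI; (intro regular_intros d F_forms_add assms)?;
        simp add: even_form_apply deriv_add_sec plus_sec_apply r field_simps del: plus_fun_apply)
  show "even_form (sec_scale c e) g = sec_scale c (even_form e g)"
    by (rule sec_eqI; (intro regular_intros d F_forms_scale assms)?;
        simp add: even_form_apply deriv_scale_sec r field_simps)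
qed

lemma odd_form_linear:
  assumes "p \<in> spinors" "q \<in> spinors" "s \<in> spinors"
  shows "odd_form (p + q) s = odd_form p s + odd_form q s"
    "odd_form (sec_scale c p) s = sec_scale c (odd_form p s)"
proof -
  note r = F_forms_regular[OF assms(1)] F_forms_regular[OF assms(2)] F_forms_regular[OF assms(3)]
  note d = differentials_regular[OF odd_form_differential]
  show "odd_form (p + q) s = odd_form p s + odd_form q s"
    by (rule sec_eqI; (intro regular_intros d F_forms_add assms)?;
        simp add: odd_form_apply deriv_add_sec plus_sec_apply r field_simps del: plus_fun_apply)
  show "odd_form (sec_scale c p) s = sec_scale c (odd_form p s)"
    by (rule sec_eqI; (intro regular_intros d F_forms_scale assms)?;
        simp add: odd_form_apply deriv_scale_sec r field_simps)
qed

text \<open>The Wronskian determinant of three vector fields. Its weight is \<open>3 * (-1) + 0 + 1 + 2 = 0\<close>, so it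
  is a function on the surface.\<close>

definition wronskian :: "'i lsection \<Rightarrow> 'i lsection \<Rightarrow> 'i lsection \<Rightarrow> 'i lsection" where
  "wronskian e f g = (\<lambda>i x.
     e i x * (deriv (f i) x * deriv (deriv (g i)) x - deriv (g i) x * deriv (deriv (f i)) x)
   + f i x * (deriv (g i) x * deriv (deriv (e i)) x - deriv (e i) x * deriv (deriv (g i)) x)
   + g i x * (deriv (e i) x * deriv (deriv (f i)) x - deriv (f i) x * deriv (deriv (e i)) x))"

text \<open>An invariant trilinear differential operator of order two from a vector field and two spinors to
  functions. The coefficients are those for which its derivative is the integrand of the cocycle
  identity with two odd arguments.\<close>

definition transvectant :: "'i lsection \<Rightarrow> 'i lsection \<Rightarrow> 'i lsection \<Rightarrow> 'i lsection" where
  "transvectant e p q = (\<lambda>i x.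
     - 1/2 * (deriv (deriv (e i)) x * p i x * q i x)
     + 1/2 * (deriv (e i) x * (deriv (p i) x * q i x + p i x * deriv (q i) x))
     + 1/2 * (e i x * (deriv (deriv (p i)) x * q i x + p i x * deriv (deriv (q i)) x))
     - e i x * deriv (p i) x * deriv (q i) x)"

lemma wronskian_invariant:
  assumes e: "e \<in> vfields" and f: "f \<in> vfields" and g: "g \<in> vfields"
    and ij: "i \<in> index L" "j \<in> index L" "y \<in> ovl i j"
  shows "wronskian e f g j (chg i j y) = wronskian e f g i y"
proof -
  let ?y = "chg i j y" and ?h = "half i j y"
  have "wronskian e f g j ?y =
     e i y * (deriv (f j) ?y * (deriv (deriv (g j)) ?y * ?h\<^sup>2) - deriv (g j) ?y * (deriv (deriv (f j)) ?y * ?h\<^sup>2))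
   + f i y * (deriv (g j) ?y * (deriv (deriv (e j)) ?y * ?h\<^sup>2) - deriv (e j) ?y * (deriv (deriv (g j)) ?y * ?h\<^sup>2))
   + g i y * (deriv (e j) ?y * (deriv (deriv (f j)) ?y * ?h\<^sup>2) - deriv (f j) ?y * (deriv (deriv (e j)) ?y * ?h\<^sup>2))"
    unfolding wronskian_def vfield_change(1)[OF e ij] vfield_change(1)[OF f ij] vfield_change(1)[OF g ij]
    by (simp add: algebra_simps)
  also have "\<dots> = wronskian e f g i y"
    unfolding wronskian_def vfield_change(2,3)[OF e ij] vfield_change(2,3)[OF f ij]
      vfield_change(2,3)[OF g ij]
    by (simp add: algebra_simps)
  finally show ?thesis .
qed

lemma transvectant_invariant:
  assumes e: "e \<in> vfields" and p: "p \<in> spinors" and q: "q \<in> spinors"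
    and ij: "i \<in> index L" "j \<in> index L" "y \<in> ovl i j"
  shows "transvectant e p q j (chg i j y) = transvectant e p q i y"
proof -
  let ?y = "chg i j y" and ?h = "half i j y"
  have "transvectant e p q j ?y =
     - 1/2 * (deriv (deriv (e j)) ?y * ?h\<^sup>2 * p i y * q i y)
     + 1/2 * (deriv (e j) ?y * (deriv (p j) ?y * ?h * q i y + p i y * (deriv (q j) ?y * ?h)))
     + 1/2 * (e i y * (deriv (deriv (p j)) ?y * ?h ^ 3 * q i y + p i y * (deriv (deriv (q j)) ?y * ?h ^ 3)))
     - e i y * (deriv (p j) ?y * ?h) * (deriv (q j) ?y * ?h)"
    unfolding transvectant_def vfield_change(1)[OF e ij] spinor_change(1)[OF p ij]
      spinor_change(1)[OF q ij]
    by (simp add: field_simps power2_eq_square power3_eq_cube)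
  also have "\<dots> = transvectant e p q i y"
    unfolding transvectant_def vfield_change(2,3)[OF e ij] spinor_change(2,3)[OF p ij]
      spinor_change(2,3)[OF q ij]
    by (simp add: field_simps power2_eq_square)
  finally show ?thesis .
qed

text \<open>The terms with \<open>R\<close> cancel in the cyclic sum, the fourth derivatives cancel as well, and what remains
  is the cyclic sum of \<open>e''' (f g' - f' g)\<close> up to a factor, which is the determinant with rows
  \<open>e, e', e'''\<close> and hence the derivative of the Wronskian.\<close>

lemma even_cocycle_exact:
  assumes "e \<in> vfields" "f \<in> vfields" "g \<in> vfields" "i \<in> index L" "x \<in> reg i"
  shows "(wronskian e f g i has_field_derivative
      - 2 * (even_form e (vf_bracket f g) + even_form f (vf_bracket g e)
        + even_form g (vf_bracket e f)) i x) (at x)"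
proof -
  note r = F_forms_regular[OF assms(1)] F_forms_regular[OF assms(2)] F_forms_regular[OF assms(3)]
  note jets = regular_jet[OF r(1) assms(4,5)] regular_jet[OF r(2) assms(4,5)]
    regular_jet[OF r(3) assms(4,5)]
  show ?thesis
    unfolding wronskian_def
    by (auto intro!: derivative_eq_intros jets
        simp: even_form_apply deriv_bracket r assms field_simps)
qed

text \<open>The terms with \<open>R\<close> cancel because of \<open>p (e.q) + q (e.p) = [e, p q]\<close>. This fixes the
  relative factor of the even and the odd integrand.\<close>

lemma mixed_cocycle_exact:
  assumes "e \<in> vfields" "p \<in> spinors" "q \<in> spinors" "i \<in> index L" "x \<in> reg i"
  shows "(transvectant e p q i has_field_derivative
      (even_form e (sec_mult p q) + odd_form p (vf_action e q) + odd_form q (vf_action e p)) i x) (at x)"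
proof -
  note r = F_forms_regular[OF assms(1)] F_forms_regular[OF assms(2)] F_forms_regular[OF assms(3)]
  note jets = regular_jet[OF r(1) assms(4,5)] regular_jet[OF r(2) assms(4,5)]
    regular_jet[OF r(3) assms(4,5)]
  show ?thesis
    unfolding transvectant_def
    by (auto intro!: derivative_eq_intros jets
        simp: even_form_apply odd_form_apply deriv_mult_sec deriv_action r assms field_simps)
qed

end

section \<open>Integration along the curve\<close>

locale theta_curve = theta_surface X \<A> A L
  for X :: "'p topology" and \<A> :: "'p coordinate set" and A :: "'p set"
    and L :: "('i, 'p) hol_bundle" +
  fixes C :: "real \<Rightarrow> 'p"
  assumes curve: "closed_differentiable_curve X \<A> C" and avoids: "C ` {0..1} \<inter> A = {}"
begin

abbreviation "lift i \<equiv> z_of L i \<circ> C"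

lemma curve_continuous: "continuous_map (top_of_set {0..1}) X C"
  using curve unfolding closed_differentiable_curve_def pathin_def by blast

lemma curve_point: "t \<in> {0..1} \<Longrightarrow> C t \<in> topspace X"
  using curve_continuous unfolding continuous_map_def by auto

lemma curve_near:
  assumes "openin X U" "t \<in> {0..1}" "C t \<in> U"
  obtains d where "d > 0" "\<And>s. s \<in> {0..1} \<Longrightarrow> dist s t < d \<Longrightarrow> C s \<in> U"
proof -
  have "openin (top_of_set {0..1}) {s \<in> topspace (top_of_set {0..1}). C s \<in> U}"
    using curve_continuous assms(1) by (rule openin_continuous_map_preimage)
  then show ?thesis
    using assms that unfolding openin_euclidean_subtopology_iff by force
qed

text \<open>Differentiability of the curve is assumed in the charts of the atlas only. It passes to every
  holomorphic coordinate by the chain rule, since the curve stays in both patches for nearby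
  parameters.\<close>

lemma lift_derivative_change:
  assumes c: "hol_coord c" and d: "hol_coord d" and t: "t \<in> {0..1}"
    and p: "C t \<in> fst c" "C t \<in> fst d"
    and v: "((snd c \<circ> C) has_vector_derivative v) (at t within {0..1})"
  shows "((snd d \<circ> C) has_vector_derivative deriv (change c d) (snd c (C t)) * v) (at t within {0..1})"
proof -
  have x: "snd c (C t) \<in> overlap c d" using p by (auto simp: overlap_def)
  have "(change c d has_field_derivative deriv (change c d) (snd c (C t)))
      (at ((snd c \<circ> C) t) within (snd c \<circ> C) ` {0..1})"
    using holomorphic_derivI[OF change_holomorphic[OF c d]
        open_overlap[OF hol_coord_chart[OF c] hol_coord_chart[OF d]] x] by simp
  from field_vector_diff_chain_within[OF v this]
  have D: "((change c d \<circ> (snd c \<circ> C)) has_vector_derivative deriv (change c d) (snd c (C t)) * v)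
      (at t within {0..1})" by (subst mult.commute)
  obtain r where r: "r > 0" "\<And>s. s \<in> {0..1} \<Longrightarrow> dist s t < r \<Longrightarrow> C s \<in> fst c \<inter> fst d"
    using curve_near[OF openin_Int[OF open_patch[OF c] open_patch[OF d]] t] p by blast
  show ?thesis
  proof (rule has_vector_derivative_transform_within[OF D r(1) t])
    fix s assume "s \<in> {0..1}" "dist s t < r"
    then show "(change c d \<circ> (snd c \<circ> C)) s = (snd d \<circ> C) s"
      using r(2) hol_coord_chart[OF c] by (auto simp: change_chart[of X])
  qed
qed

definition vel :: "'i \<Rightarrow> real \<Rightarrow> complex" where
  "vel i t = vector_derivative (lift i) (at t within {0..1})"

lemma vel:
  assumes i: "i \<in> index L" and t: "t \<in> {0..1}" and p: "C t \<in> patch L i"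
  shows "(lift i has_vector_derivative vel i t) (at t within {0..1})"
proof -
  obtain a where a: "a \<in> \<A>" "C t \<in> fst a" using atlas_covers[OF curve_point[OF t]] .
  then have "(snd a \<circ> C) differentiable (at t within {0..1})"
    using curve t unfolding closed_differentiable_curve_def by blast
  then have "((snd a \<circ> C) has_vector_derivative vector_derivative (snd a \<circ> C) (at t within {0..1}))
      (at t within {0..1})"
    using vector_derivative_works by blast
  from lift_derivative_change[OF atlas_hol_coord[OF a(1)] frame_hol_coord[OF i] t a(2) p this]
  show ?thesis
    unfolding vel_def by (metis vector_derivative_works differentiableI_vector)
qed

lemma vel_change:
  assumes ij: "i \<in> index L" "j \<in> index L" and t: "t \<in> {0..1}"
    and p: "C t \<in> patch L i" "C t \<in> patch L j"
  shows "vel j t = deriv (chg i j) (lift i t) * vel i t"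
proof -
  have "(lift j has_vector_derivative deriv (chg i j) (lift i t) * vel i t) (at t within {0..1})"
    using lift_derivative_change[OF frame_hol_coord[OF ij(1)] frame_hol_coord[OF ij(2)] t p
        vel[OF ij(1) t p(1)]] by simp
  then show ?thesis
    using vector_derivative_unique_within_closed_interval[of 0 1 t "lift j"] vel[OF ij(2) t p(2)] t
    by (simp flip: box_real)
qed

definition frame_at :: "real \<Rightarrow> 'i" where
  "frame_at t = (SOME i. i \<in> index L \<and> C t \<in> patch L i)"

lemma frame_at:
  assumes "t \<in> {0..1}"
  shows "frame_at t \<in> index L" "C t \<in> patch L (frame_at t)"
proof -
  have "\<exists>i. i \<in> index L \<and> C t \<in> patch L i"
    using frames_cover[OF curve_point[OF assms]] by blast
  from someI_ex[OF this] show "frame_at t \<in> index L" "C t \<in> patch L (frame_at t)"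
    unfolding frame_at_def by auto
qed

text \<open>The pullback of a differential to the parameter interval, computed in an arbitrarily chosen frame at
  each parameter. The choice is irrelevant for differentials, and making it independent of the
  differential turns linearity of the integral into linearity of the pullback.\<close>

definition pull :: "'i lsection \<Rightarrow> real \<Rightarrow> complex" where
  "pull w t = w (frame_at t) (lift (frame_at t) t) * vel (frame_at t) t"

lemma lift_ovl:
  assumes "t \<in> {0..1}" "C t \<in> patch L i" "C t \<in> patch L j"
  shows "lift i t \<in> ovl i j"
proof -
  have "C t \<notin> A" using assms(1) avoids by blast
  with assms show ?thesis by (auto simp: ovl_def)
qed

lemma lift_reg:
  assumes "t \<in> {0..1}" "C t \<in> patch L i"
  shows "lift i t \<in> reg i"
  using lift_ovl[OF assms assms(2)] ovl_subset_reg by blast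

lemma chg_lift: "i \<in> index L \<Longrightarrow> C t \<in> patch L i \<Longrightarrow> chg i j (lift i t) = lift j t"
  using frame_chart by (simp add: change_chart[of X])

lemma pull_eq:
  assumes w: "w \<in> differentials" and i: "i \<in> index L" and t: "t \<in> {0..1}" and p: "C t \<in> patch L i"
  shows "pull w t = w i (lift i t) * vel i t"
proof -
  let ?j = "frame_at t"
  note j = frame_at[OF t]
  have y: "lift i t \<in> ovl i ?j" by (rule lift_ovl[OF t p j(2)])
  have "w ?j (lift ?j t) * (half i ?j (lift i t))\<^sup>2 = w i (lift i t)"
    using w i j(1) y chg_lift[OF i p] unfolding differentials_iff by metis
  moreover have "vel ?j t = (half i ?j (lift i t))\<^sup>2 * vel i t"
    using vel_change[OF i j(1) t p j(2)]
      half_jacobian.deriv_f[OF half_jacobian_change[OF i j(1)] y] by simp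
  ultimately show ?thesis unfolding pull_def by simp
qed

lemma primitive_along_curve:
  assumes w: "w \<in> differentials" and i: "i \<in> index L" and t: "t \<in> {0..1}" and p: "C t \<in> patch L i"
    and P: "(P has_field_derivative w i (lift i t)) (at (lift i t))"
  shows "((\<lambda>s. P (lift i s)) has_vector_derivative pull w t) (at t within {0..1})"
  using field_vector_diff_chain_within[OF vel[OF i t p] has_field_derivative_at_within[OF P]]
  unfolding pull_eq[OF w i t p] by (simp add: o_def mult.commute)

text \<open>The velocity of a curve that is merely differentiable may be discontinuous and unbounded, so
  continuity of the integrand is not available. Instead the pullback has a primitive near
  each parameter, namely a local primitive of the differential composed with the curve. A derivative
  is always integrable in the sense of Henstock and Kurzweil, and local integrability suffices on a
  compact interval.\<close>

lemma pull_integrable: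
  assumes w: "w \<in> differentials"
  shows "pull w integrable_on {0..1}"
proof -
  have "\<exists>d>0. \<forall>u v. t \<in> cbox u v \<and> cbox u v \<subseteq> ball t d \<and> cbox u v \<subseteq> cbox 0 1 \<longrightarrow>
      pull w integrable_on cbox u v" if "t \<in> cbox 0 1" for t :: real
  proof -
    have t: "t \<in> {0..1}" using that by simp
    obtain i where i: "i \<in> index L" "C t \<in> patch L i" using frame_at[OF t] by blast
    obtain r where r: "r > 0" "ball (lift i t) r \<subseteq> reg i"
      using open_contains_ball open_reg[OF i(1)] lift_reg[OF t i(2)] by blast
    have "w i holomorphic_on ball (lift i t) r"
      by (rule holomorphic_on_subset[OF regular_holo[OF _ i(1)] r(2)])
         (use w in \<open>simp add: differentials_iff\<close>)
    then obtain P where P: "\<And>x. x \<in> ball (lift i t) r \<Longrightarrow>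
        (P has_field_derivative w i x) (at x within ball (lift i t) r)"
      using holomorphic_convex_primitive'[OF convex_ball open_ball] by metis
    \<comment> \<open>parameters so close to \<open>t\<close> that the curve stays in the patch and in the disc carrying the primitive\<close>
    obtain d1 where d1: "d1 > 0" "\<And>s. s \<in> {0..1} \<Longrightarrow> dist s t < d1 \<Longrightarrow> C s \<in> patch L i"
      using curve_near[OF open_patch[OF frame_hol_coord[OF i(1)]] t i(2)] by blast
    have "continuous (at t within {0..1}) (lift i)"
      using vel[OF i(1) t i(2)] has_vector_derivative_continuous by blast
    then obtain d2 where d2: "d2 > 0"
        "\<And>s. s \<in> {0..1} \<Longrightarrow> dist s t < d2 \<Longrightarrow> dist (lift i s) (lift i t) < r"
      using r(1) unfolding continuous_within_eps_delta by blast
    have "pull w integrable_on cbox u v"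
      if uv: "t \<in> cbox u v" "cbox u v \<subseteq> ball t (min d1 d2)" "cbox u v \<subseteq> cbox 0 1" for u v :: real
    proof -
      have "((\<lambda>s. P (lift i s)) has_vector_derivative pull w s) (at s within {u..v})"
        if s: "s \<in> {u..v}" for s
      proof -
        have s1: "s \<in> {0..1}" using s uv(3) by auto
        have "s \<in> ball t (min d1 d2)" using s uv(2) by auto
        then have sd: "dist s t < d1" "dist s t < d2" by (auto simp: dist_commute)
        have sp: "C s \<in> patch L i" using d1(2)[OF s1 sd(1)] .
        have sb: "lift i s \<in> ball (lift i t) r" using d2(2)[OF s1 sd(2)] by (simp add: dist_commute)
        have "(P has_field_derivative w i (lift i s)) (at (lift i s))"
          using P[OF sb] at_within_open[OF sb open_ball] by simp
        from primitive_along_curve[OF w i(1) s1 sp this] show ?thesis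
          using uv(3) by (auto intro: has_vector_derivative_within_subset)
      qed
      moreover have "u \<le> v" using uv(1) by auto
      ultimately show ?thesis
        using fundamental_theorem_of_calculus[of u v "\<lambda>s. P (lift i s)" "pull w"]
        unfolding integrable_on_def by auto
    qed
    moreover have "min d1 d2 > 0" using d1(1) d2(1) by simp
    ultimately show ?thesis by blast
  qed
  then have "pull w integrable_on cbox 0 1"
    by (intro integrable_on_little_subintervals) blast
  then show ?thesis by simp
qed

lemma has_curve_integral_iff:
  assumes w: "w \<in> differentials"
  shows "has_curve_integral L w C v \<longleftrightarrow> (pull w has_integral v) {0..1}"
proof
  assume "has_curve_integral L w C v"
  then obtain h where h: "\<forall>t\<in>{0..1}. \<forall>i\<in>index L. C t \<in> patch L i \<longrightarrow>
      h t = w i (z_of L i (C t)) * vector_derivative (lift i) (at t within {0..1})"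
    "(h has_integral v) {0..1}"
    unfolding has_curve_integral_def by blast
  have "h t = pull w t" if t: "t \<in> {0..1}" for t
    using h(1) t frame_at[OF t] unfolding pull_def vel_def by simp
  then show "(pull w has_integral v) {0..1}" using h(2) has_integral_eq by blast
next
  assume "(pull w has_integral v) {0..1}"
  moreover have "\<forall>t\<in>{0..1}. \<forall>i\<in>index L. C t \<in> patch L i \<longrightarrow>
      pull w t = w i (z_of L i (C t)) * vector_derivative (lift i) (at t within {0..1})"
    using pull_eq[OF w] unfolding vel_def by simp
  ultimately show "has_curve_integral L w C v"
    unfolding has_curve_integral_def by blast
qed

lemma curve_integral_exists: "w \<in> differentials \<Longrightarrow> \<exists>v. has_curve_integral L w C v"
  using has_curve_integral_iff pull_integrable unfolding integrable_on_def by blast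

lemma curve_integral_eq:
  assumes w: "w \<in> differentials"
  shows "curve_integral L C w = integral {0..1} (pull w)"
proof -
  have "(pull w has_integral integral {0..1} (pull w)) {0..1}"
    by (rule integrable_integral[OF pull_integrable[OF w]])
  then show ?thesis
    unfolding curve_integral_def has_curve_integral_iff[OF w]
    by (blast intro: the_equality has_integral_unique)
qed

lemma curve_integral_add:
  assumes v: "v \<in> differentials" and w: "w \<in> differentials" and vw: "v + w \<in> differentials"
  shows "curve_integral L C (v + w) = curve_integral L C v + curve_integral L C w"
proof -
  have "pull (v + w) = (\<lambda>t. pull v t + pull w t)"
    by (simp add: pull_def fun_eq_iff algebra_simps)
  then show ?thesis
    unfolding curve_integral_eq[OF v] curve_integral_eq[OF w] curve_integral_eq[OF vw]
    using integral_add[OF pull_integrable[OF v] pull_integrable[OF w]] by simp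
qed

lemma curve_integral_scale:
  assumes v: "v \<in> differentials" and w: "sec_scale c v \<in> differentials"
  shows "curve_integral L C (sec_scale c v) = c * curve_integral L C v"
proof -
  have "pull (sec_scale c v) = (\<lambda>t. c * pull v t)"
    by (simp add: pull_def fun_eq_iff)
  then show ?thesis
    unfolding curve_integral_eq[OF v] curve_integral_eq[OF w] by simp
qed

text \<open>A function on the surface outside \<open>A\<close> with \<open>dP = w\<close> is a primitive of the pullback along the whole
  curve, with equal values at both ends because the curve is closed.\<close>

lemma curve_integral_exact:
  assumes w: "w \<in> differentials"
    and P: "\<And>i x. i \<in> index L \<Longrightarrow> x \<in> reg i \<Longrightarrow> (P i has_field_derivative w i x) (at x)"
    and inv: "\<And>i j y. i \<in> index L \<Longrightarrow> j \<in> index L \<Longrightarrow> y \<in> ovl i j \<Longrightarrow> P j (chg i j y) = P i y"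
  shows "curve_integral L C w = 0"
proof -
  define G where "G t = P (frame_at t) (lift (frame_at t) t)" for t
  have G: "G t = P i (lift i t)" if "i \<in> index L" "t \<in> {0..1}" "C t \<in> patch L i" for i t
    unfolding G_def using inv[OF that(1) frame_at(1)[OF that(2)]
        lift_ovl[OF that(2,3) frame_at(2)[OF that(2)]]] chg_lift[OF that(1,3)] by metis
  have "(G has_vector_derivative pull w t) (at t within {0..1})" if t: "t \<in> {0..1}" for t
  proof -
    obtain i where i: "i \<in> index L" "C t \<in> patch L i" using frame_at[OF t] by blast
    obtain d where d: "d > 0" "\<And>s. s \<in> {0..1} \<Longrightarrow> dist s t < d \<Longrightarrow> C s \<in> patch L i"
      using curve_near[OF open_patch[OF frame_hol_coord[OF i(1)]] t i(2)] by blast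
    show ?thesis
      by (rule has_vector_derivative_transform_within
          [OF primitive_along_curve[OF w i(1) t i(2) P[OF i(1) lift_reg[OF t i(2)]]] d(1) t])
         (use G[OF i(1)] d(2) in auto)
  qed
  then have "(pull w has_integral (G 1 - G 0)) {0..1}"
    by (intro fundamental_theorem_of_calculus) auto
  moreover have "G 1 = G 0"
    using curve unfolding closed_differentiable_curve_def G_def frame_at_def o_def by simp
  ultimately show ?thesis
    unfolding curve_integral_eq[OF w] by (simp add: integral_unique)
qed

end

section \<open>The cocycle\<close>

locale theta_cocycle = theta_connection X \<A> A L \<V> R + theta_curve X \<A> A L C
  for X :: "'p topology" and \<A> :: "'p coordinate set" and A :: "'p set"
    and L :: "('i, 'p) hol_bundle"
    and \<V> :: "'p coordinate set" and R :: "'p coordinate \<Rightarrow> complex \<Rightarrow> complex"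
    and C :: "real \<Rightarrow> 'p"
begin

abbreviation "\<Phi> \<equiv> Phi L C \<V> R"
abbreviation "CI \<equiv> curve_integral L C"

lemmas form_intros = even_form_differential odd_form_differential bracket_closed action_closed
  mult_closed differentials_add

text \<open>The normalising constant is kept opaque so that only linear algebra remains.\<close>

definition kappa :: complex where "kappa = 1 / (24 * of_real pi * \<i>)"

lemma Phi_apply: "\<Phi> (e, p) (f, q) = kappa * (CI (even_form e f) - CI (odd_form p q))"
  by (simp add: Phi_def Phi_even_def Phi_odd_def kappa_def diff_divide_distrib)

lemma even_CI_cocycle:
  assumes "e \<in> vfields" "f \<in> vfields" "g \<in> vfields"
  shows "CI (even_form e (vf_bracket f g)) + CI (even_form f (vf_bracket g e))
    + CI (even_form g (vf_bracket e f)) = 0"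
proof -
  let ?w = "even_form e (vf_bracket f g) + even_form f (vf_bracket g e)
      + even_form g (vf_bracket e f)"
  have "CI ?w = 0"
  proof (rule curve_integral_exact[where P = "\<lambda>i x. (-1/2) * wronskian e f g i x"])
    show "?w \<in> differentials" by (intro form_intros assms)
    fix i x assume ix: "i \<in> index L" "x \<in> reg i"
    show "((\<lambda>x. (-1/2) * wronskian e f g i x) has_field_derivative ?w i x) (at x)"
      by (rule DERIV_cong[OF DERIV_cmult[OF even_cocycle_exact[OF assms ix]]]) (simp add: field_simps)
  qed (simp add: wronskian_invariant assms)
  then show ?thesis
    by (simp add: curve_integral_add form_intros assms)
qed

lemma mixed_CI_cocycle:
  assumes "e \<in> vfields" "p \<in> spinors" "q \<in> spinors"
  shows "CI (even_form e (sec_mult p q)) + CI (odd_form p (vf_action e q))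
    + CI (odd_form q (vf_action e p)) = 0"
proof -
  let ?w = "even_form e (sec_mult p q) + odd_form p (vf_action e q) + odd_form q (vf_action e p)"
  have "CI ?w = 0"
    by (rule curve_integral_exact[where P = "transvectant e p q"])
       (auto intro!: form_intros assms mixed_cocycle_exact transvectant_invariant
         simp del: plus_fun_apply)
  then show ?thesis
    by (simp add: curve_integral_add form_intros assms)
qed

lemma zero_forms:
  "even_form 0 e = 0" "even_form e 0 = 0" "odd_form 0 p = 0" "odd_form p 0 = 0"
proof -
  have z: "deriv (0 :: complex \<Rightarrow> complex) = 0"
    by (simp add: zero_fun_def fun_eq_iff)
  show "even_form 0 e = 0" "even_form e 0 = 0" "odd_form 0 p = 0" "odd_form p 0 = 0"
    by (simp_all add: fun_eq_iff even_form_apply odd_form_apply z)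
qed

lemma CI_zero: "CI 0 = 0"
proof -
  have "(0 :: 'i lsection) \<in> differentials" unfolding differentials_eq by (rule F_forms_zero)
  then show ?thesis
    using curve_integral_scale[of 0 0] by (simp add: scale_linear)
qed

lemma CI_minus:
  assumes "w \<in> differentials"
  shows "CI (- w) = - CI w"
  using curve_integral_scale[OF assms differentials_scale[OF assms], of "-1"]
  unfolding sec_scale_minus_one by simp

lemma CI_odd_minus:
  assumes "p \<in> spinors" "q \<in> spinors"
  shows "CI (odd_form (- p) q) = - CI (odd_form p q)" "CI (odd_form p (- q)) = - CI (odd_form p q)"
proof -
  have "CI (odd_form (- p) q) = - CI (odd_form p q)" if "p \<in> spinors" "q \<in> spinors" for p q
    using odd_form_linear(2)[of p p q "-1"] that CI_minus[OF odd_form_differential]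
    unfolding sec_scale_minus_one by simp
  from this[OF assms] this[OF assms(2,1)] odd_form_swap
  show "CI (odd_form (- p) q) = - CI (odd_form p q)" "CI (odd_form p (- q)) = - CI (odd_form p q)"
    by metis+
qed

lemma Phi_swap:
  assumes "e \<in> vfields" "f \<in> vfields"
  shows "\<Phi> (f, q) (e, p) = - kappa * (CI (even_form e f) + CI (odd_form p q))"
  using CI_minus[OF even_form_differential[OF assms]]
  unfolding Phi_apply odd_form_swap[of q p] even_form_swap[of f e] by (simp add: algebra_simps)

lemma Phi_bilinear: "bilinear_map_on (scl KN) (*) (total KN) \<Phi>"
proof -
  have left_add: "\<Phi> (e + f, p + q) (g, s) = \<Phi> (e, p) (g, s) + \<Phi> (f, q) (g, s)"
    if "e \<in> vfields" "f \<in> vfields" "g \<in> vfields" "p \<in> spinors" "q \<in> spinors" "s \<in> spinors" for e f g p q s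
    using that unfolding Phi_apply
    by (simp add: even_form_linear odd_form_linear curve_integral_add curve_integral_scale
        form_intros differentials_scale algebra_simps)
  have left_scale: "\<Phi> (sec_scale c e, sec_scale c p) (g, s) = c * \<Phi> (e, p) (g, s)"
    if "e \<in> vfields" "g \<in> vfields" "p \<in> spinors" "s \<in> spinors" for e g p s c
    using that unfolding Phi_apply
    by (simp add: even_form_linear odd_form_linear curve_integral_add curve_integral_scale
        form_intros differentials_scale algebra_simps)
  have right_add: "\<Phi> (g, s) (e + f, p + q) = \<Phi> (g, s) (e, p) + \<Phi> (g, s) (f, q)"
    if "e \<in> vfields" "f \<in> vfields" "g \<in> vfields" "p \<in> spinors" "q \<in> spinors" "s \<in> spinors" for e f g p q s
    using that
    by (simp add: Phi_swap F_forms_add F_forms_scale even_form_linear odd_form_linear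
        curve_integral_add curve_integral_scale form_intros differentials_scale algebra_simps)
  have right_scale: "\<Phi> (g, s) (sec_scale c e, sec_scale c p) = c * \<Phi> (g, s) (e, p)"
    if "e \<in> vfields" "g \<in> vfields" "p \<in> spinors" "s \<in> spinors" for e g p s c
    using that
    by (simp add: Phi_swap F_forms_add F_forms_scale even_form_linear odd_form_linear
        curve_integral_add curve_integral_scale form_intros differentials_scale algebra_simps)
  show ?thesis
    unfolding bilinear_map_on_def total_KN
    by (simp add: split_paired_all Ball_def KN_simps left_add left_scale right_add right_scale)
qed

text \<open>With one or three odd arguments every summand pairs elements of different parity. No or two odd
  arguments lead to the two vanishing integrals, up to a cyclic permutation.\<close>

lemma Phi_jacobi:
  assumes "p \<in> {0, 1}" "q \<in> {0, 1}" "r \<in> {0, 1}"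
    "x \<in> part KN p" "y \<in> part KN q" "z \<in> part KN r"
  shows "(-1) ^ (p * r) * \<Phi> x (brk KN y z) + (-1) ^ (q * p) * \<Phi> y (brk KN z x) +
        (-1) ^ (r * q) * \<Phi> z (brk KN x y) = 0"
proof -
  obtain e s where x: "x = (e, s)" by fastforce
  obtain f t where y: "y = (f, t)" by fastforce
  obtain g u where z: "z = (g, u)" by fastforce
  note simps = KN_simps Phi_apply zero_forms CI_zero CI_odd_minus action_closed
  have mixed: "CI (even_form e (sec_mult t u)) =
      - CI (odd_form t (vf_action e u)) - CI (odd_form u (vf_action e t))"
    if "e \<in> vfields" "t \<in> spinors" "u \<in> spinors" for e t u
    using mixed_CI_cocycle[OF that] by (simp add: algebra_simps eq_neg_iff_add_eq_0)
  consider "p = 0" "q = 0" "r = 0" | "p = 0" "q = 0" "r = 1" | "p = 0" "q = 1" "r = 0"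
    | "p = 1" "q = 0" "r = 0" | "p = 0" "q = 1" "r = 1" | "p = 1" "q = 0" "r = 1"
    | "p = 1" "q = 1" "r = 0" | "p = 1" "q = 1" "r = 1"
    using assms(1-3) by blast
  then show ?thesis
  proof cases
    case 1 then show ?thesis
      using assms even_CI_cocycle[of e f g] unfolding x y z
      by (simp add: simps flip: distrib_left)
  next
    case 2 then show ?thesis using assms unfolding x y z by (simp add: simps)
  next
    case 3 then show ?thesis using assms unfolding x y z by (simp add: simps)
  next
    case 4 then show ?thesis using assms unfolding x y z by (simp add: simps)
  next
    case 5 then show ?thesis using assms unfolding x y z by (simp add: simps mixed algebra_simps)
  next
    case 6 then show ?thesis using assms unfolding x y z by (simp add: simps mixed algebra_simps)
  next
    case 7 then show ?thesis using assms unfolding x y z by (simp add: simps mixed algebra_simps)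
  next
    case 8 then show ?thesis using assms unfolding x y z by (simp add: simps)
  qed
qed

proposition Phi_even_super_cocycle: "even_super_cocycle KN \<Phi>"
  unfolding even_super_cocycle_def
proof (intro conjI)
  show "bilinear_map_on (scl KN) (*) (total KN) \<Phi>" by (rule Phi_bilinear)
  show "\<forall>x\<in>part KN 0. \<forall>y\<in>part KN 1. \<Phi> x y = 0 \<and> \<Phi> y x = 0"
    by (simp add: split_paired_all Ball_def KN_simps Phi_apply zero_forms CI_zero)
  have "\<Phi> x y = - ((-1) ^ (p * q)) * \<Phi> y x"
    if "p \<in> {0, 1}" "q \<in> {0, 1}" "x \<in> part KN p" "y \<in> part KN q" for p q x y
  proof -
    obtain e s where x: "x = (e, s)" by fastforce
    obtain f t where y: "y = (f, t)" by fastforce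
    have ef: "e \<in> vfields" "f \<in> vfields"
      using that unfolding x y by (auto simp: KN_simps F_forms_zero)
    show ?thesis
      using that unfolding x y Phi_swap[OF ef] Phi_apply[of e s f t]
      by (auto simp: KN_simps zero_forms CI_zero)
  qed
  then show "\<forall>p\<in>{0, 1}. \<forall>q\<in>{0, 1}. \<forall>x\<in>part KN p. \<forall>y\<in>part KN q.
      \<Phi> x y = - ((-1) ^ (p * q)) * \<Phi> y x"
    by (intro ballI)
qed (intro ballI Phi_jacobi; assumption)

end

theorem proposition5p1:
  fixes X :: "'p topology" and \<A> :: "'p coordinate set"
    and A :: "'p set" and L :: "('i, 'p) hol_bundle"
    and C :: "real \<Rightarrow> 'p"
    and \<V> :: "'p coordinate set" and R :: "'p coordinate \<Rightarrow> complex \<Rightarrow> complex"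
  assumes "compact_riemann_surface X \<A>"
    and "finite A" and "A \<subseteq> topspace X"
    and "theta_characteristic X \<A> L"
    and "closed_differentiable_curve X \<A> C" and "C ` {0..1} \<inter> A = {}"
    and "projective_connection X \<A> \<V> R"
  shows
    \<comment> \<open>the integrands are well-defined (meromorphic) differentials, integrable along \<open>C\<close>\<close>
    "(\<forall>e\<in>F_forms A L (-2). \<forall>f\<in>F_forms A L (-2).
        even_integrand L \<V> R e f \<in> meromorphic_sections A (canonical_bundle L) \<and>
        (\<exists>v. has_curve_integral L (even_integrand L \<V> R e f) C v)) \<and>
     (\<forall>\<phi>\<in>F_forms A L (-1). \<forall>\<psi>\<in>F_forms A L (-1).
        odd_integrand L \<V> R \<phi> \<psi> \<in> meromorphic_sections A (canonical_bundle L) \<and>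
        (\<exists>v. has_curve_integral L (odd_integrand L \<V> R \<phi> \<psi>) C v)) \<and>
     even_super_cocycle (KN_superalgebra A L) (Phi L C \<V> R) \<and>
     is_central_extension (extension (KN_superalgebra A L) (Phi L C \<V> R)) (1, 0) snd
       (KN_superalgebra A L)"
proof -
  interpret theta_cocycle X \<A> A L \<V> R C
    using assms by unfold_locales (auto simp: compact_riemann_surface_def)
  show ?thesis
    using even_form_differential odd_form_differential curve_integral_exists
      Phi_even_super_cocycle
      cocycle_central_extension[OF KN_lie_superalgebra Phi_even_super_cocycle]
    by blast
qed

end
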